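(* Let $d\ge 1$, $r,\xi>0$ and $\ell_0$ be given. There exist constants $c_1,c_2>0$ depending only on $d,r,\xi,\ell_0$ such that the following holds. Let $H=\sum_{i=1}^n H_i$ be a local Hamiltonian of range $\ell_0$ on $n$ spins on a $d$-dimensional hypercubic lattice, with $\|H_i\|\le 1$ and ground-state energy $0$, and let $\Omega=\sum_{i=1}^n\Omega_i$ be an observable with $\|\Omega_i\|\le 1$ and range $\ell\ge r$. Let $\beta^\ast>0$ be an arbitrary inverse temperature for which the canonical state $\rho_{\beta^\ast}=e^{-\beta^\ast H}/Z_{\beta^\ast}$ satisfies $(r,\xi)$-clustering. Then any energy eigenstate $|E_m\rangle$ of $H$ (normalized, with eigenvalue $E_m$) satisfies $$\bigl|\langle E_m|(\Omega/n)|E_m\rangle-\langle\Omega/n\rangle_\infty\bigr|\le\frac{1}{\sqrt n}\max\bigl(c_1\mathcal A_1,\;c_2\mathcal A_2\bigr),$$ where $$\mathcal A_1=\bigl[\beta^\ast E_m+\log Z_{\beta^\ast}\bigr]^{(d+1)/2},\qquad \mathcal A_2=\bigl[\ell^d(\beta^\ast E_m+\log Z_{\beta^\ast})\bigr]^{1/2}.$$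
   Context: The system consists of $n$ spin-$1/2$ degrees of freedom (Hilbert space $(\mathbb C^2)^{\otimes n}$) located on the $n$ sites of a finite $d$-dimensional hypercubic lattice; $\mathrm{dist}(i,j)$ is the Manhattan distance between sites and $\mathrm{dist}(X,Y)=\min_{i\in X,j\in Y}\mathrm{dist}(i,j)$ for sets of sites $X,Y$. $\|\cdot\|$ is the operator norm. The Hamiltonian is $H=\sum_{i=1}^n H_i$ with each $H_i$ self-adjoint, $\|H_i\|\le 1$, and $H_i$ acting non-trivially only on sites $j$ with $\mathrm{dist}(i,j)\le\ell_0$ (range $\ell_0$); no translation invariance is assumed. The smallest eigenvalue of $H$ is normalized to $0$. The observable is $\Omega=\sum_{i=1}^n\Omega_i$ with each $\Omega_i$ self-adjoint, $\|\Omega_i\|\le1$, and $\Omega_i$ acting only on sites $j$ with $\mathrm{dist}(i,j)\le\ell$ (range $\ell$). $Z_\beta=\mathrm{tr}\,e^{-\beta H}$. $\langle\cdots\rangle_\infty$ is the average in the ground state; if the ground-state space has dimension $D>1$, it is $\frac1D\sum_{m=0}^{D-1}\langle E_m|\cdots|E_m\rangle$ over an orthonormal basis of the ground-state space. A density matrix $\rho$ satisfies $(r,\xi)$-clustering if for all operators $A_X,B_Y$ supported on sets of sites $X,Y$ with $\mathrm{dist}(X,Y)\ge r$, $$|\mathrm{tr}(\rho A_XB_Y)-\mathrm{tr}(\rho A_X)\,\mathrm{tr}(\rho B_Y)|\le\|A_X\|\,\|B_Y\|\,e^{-\mathrm{dist}(X,Y)/\xi}.$$ *)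

theory Defs
  imports "Jordan_Normal_Form.Schur_Decomposition"
begin

section \<open>Linear algebra on complex matrices\<close>

definition vnorm :: "complex vec \<Rightarrow> real" where
  "vnorm v = sqrt (Re (v \<bullet>c v))"

definition op_norm :: "complex mat \<Rightarrow> real" where
  "op_norm A = (SUP v \<in> {v \<in> carrier_vec (dim_col A). vnorm v = 1}. vnorm (A *\<^sub>v v))"

definition self_adjoint :: "complex mat \<Rightarrow> bool" where
  "self_adjoint A \<longleftrightarrow> A \<in> carrier_mat (dim_row A) (dim_row A) \<and> mat_adjoint A = A"

definition trace :: "complex mat \<Rightarrow> complex" where
  "trace A = (\<Sum>a<dim_row A. A $$ (a, a))"

text \<open>The exponential series, summed entry by entry; it converges absolutely for every
  square matrix.\<close>

definition mat_exp :: "complex mat \<Rightarrow> complex mat" where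
  "mat_exp A = mat (dim_row A) (dim_row A) (\<lambda>(a, b). \<Sum>k. (A ^\<^sub>m k) $$ (a, b) / fact k)"

definition eigenspace :: "complex mat \<Rightarrow> complex \<Rightarrow> complex vec set" where
  "eigenspace A e = {v \<in> carrier_vec (dim_row A). A *\<^sub>v v = e \<cdot>\<^sub>v v}"

definition orthonormal_basis :: "nat \<Rightarrow> complex vec set \<Rightarrow> complex vec set \<Rightarrow> bool" where
  "orthonormal_basis N V B \<longleftrightarrow>
     finite B \<and> B \<subseteq> V \<and>
     (\<forall>u\<in>B. \<forall>v\<in>B. u \<bullet>c v = (if u = v then 1 else 0)) \<and>
     LinearCombinations.module.span class_ring (module_vec TYPE(complex) N) B = V"

text \<open>\<open>\<bullet>c\<close> is conjugate-linear in its second argument, so this is the matrix element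
  of \<open>A\<close> with \<open>\<psi>\<close> on both sides.\<close>

definition expect :: "complex mat \<Rightarrow> complex vec \<Rightarrow> complex" where
  "expect A \<psi> = (A *\<^sub>v \<psi>) \<bullet>c \<psi>"

definition average :: "complex mat \<Rightarrow> complex vec set \<Rightarrow> complex" where
  "average A B = (\<Sum>\<phi>\<in>B. expect A \<phi>) / of_nat (card B)"


section \<open>Spins on a finite hypercubic lattice\<close>

text \<open>A finite piece of the \<open>d\<close>-dimensional hypercubic lattice with open boundary and side
  lengths \<open>L ! 0, \<dots>, L ! (d - 1)\<close>, where \<open>d = length L\<close>.\<close>

definition lattice_box :: "nat list \<Rightarrow> nat list set" where
  "lattice_box L = {x. length x = length L \<and> (\<forall>k<length L. x ! k < L ! k)}"

definition manhattan :: "nat list \<Rightarrow> nat list \<Rightarrow> real" where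
  "manhattan x y = (\<Sum>k<length x. \<bar>real (x ! k) - real (y ! k)\<bar>)"

text \<open>The \<open>n\<close> sites are numbered \<open>0, \<dots>, n - 1\<close>, and \<open>pos i\<close> is the lattice point of
  site \<open>i\<close>.\<close>

definition set_dist :: "(nat \<Rightarrow> nat list) \<Rightarrow> nat set \<Rightarrow> nat set \<Rightarrow> real" where
  "set_dist pos X Y = Min ((\<lambda>(i, j). manhattan (pos i) (pos j)) ` (X \<times> Y))"

definition site_ball :: "nat \<Rightarrow> (nat \<Rightarrow> nat list) \<Rightarrow> nat \<Rightarrow> real \<Rightarrow> nat set" where
  "site_ball n pos i l = {j. j < n \<and> manhattan (pos i) (pos j) \<le> l}"

text \<open>The Hilbert space of \<open>n\<close> spins is \<open>carrier_vec (2 ^ n)\<close>: the index \<open>a < 2 ^ n\<close> stands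
  for the product basis vector in which the spin at site \<open>i\<close> is in the basis state \<open>bit a i\<close>.
  An operator acting only on \<open>X\<close> is the tensor product of an operator \<open>f\<close> on the spins in \<open>X\<close>
  with the identity on the other spins. The matrix elements of \<open>f\<close> are indexed by subsets of
  \<open>X\<close>, a subset being the set of sites in state \<open>1\<close>.\<close>

definition acts_on :: "nat \<Rightarrow> nat set \<Rightarrow> complex mat \<Rightarrow> bool" where
  "acts_on n X A \<longleftrightarrow> A \<in> carrier_mat (2 ^ n) (2 ^ n) \<and>
     (\<exists>f :: nat set \<Rightarrow> nat set \<Rightarrow> complex. \<forall>a < 2 ^ n. \<forall>b < 2 ^ n.
        A $$ (a, b) =
          (if \<forall>i<n. i \<notin> X \<longrightarrow> bit a i = bit b i
           then f {i \<in> X. bit a i} {i \<in> X. bit b i} else 0))"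

definition local_terms :: "nat \<Rightarrow> (nat \<Rightarrow> nat list) \<Rightarrow> real \<Rightarrow> (nat \<Rightarrow> complex mat) \<Rightarrow> bool" where
  "local_terms n pos l h \<longleftrightarrow>
     (\<forall>i<n. acts_on n (site_ball n pos i l) (h i) \<and> self_adjoint (h i) \<and> op_norm (h i) \<le> 1)"

definition site_sum :: "nat \<Rightarrow> (nat \<Rightarrow> complex mat) \<Rightarrow> complex mat" where
  "site_sum n h = mat (2 ^ n) (2 ^ n) (\<lambda>(a, b). \<Sum>i<n. h i $$ (a, b))"

definition zero_ground_energy :: "complex mat \<Rightarrow> bool" where
  "zero_ground_energy H \<longleftrightarrow>
     eigenvalue H 0 \<and> (\<forall>e::real. eigenvalue H (complex_of_real e) \<longrightarrow> 0 \<le> e)"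


section \<open>Canonical states and clustering\<close>

text \<open>The trace in the partition function is real for self-adjoint \<open>H\<close>.\<close>

definition partition_function :: "real \<Rightarrow> complex mat \<Rightarrow> real" where
  "partition_function \<beta> H = Re (trace (mat_exp (complex_of_real (- \<beta>) \<cdot>\<^sub>m H)))"

definition canonical_state :: "real \<Rightarrow> complex mat \<Rightarrow> complex mat" where
  "canonical_state \<beta> H =
     complex_of_real (1 / partition_function \<beta> H) \<cdot>\<^sub>m mat_exp (complex_of_real (- \<beta>) \<cdot>\<^sub>m H)"

text \<open>\<open>X\<close> and \<open>Y\<close> are nonempty because the distance is a minimum; for empty \<open>X\<close> or \<open>Y\<close> one of
  the operators is a scalar and the correlation vanishes in any state.\<close>

definition clustering ::
  "nat \<Rightarrow> (nat \<Rightarrow> nat list) \<Rightarrow> real \<Rightarrow> real \<Rightarrow> complex mat \<Rightarrow> bool" where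
  "clustering n pos r \<xi> \<rho> \<longleftrightarrow>
     (\<forall>X Y A B. X \<subseteq> {..<n} \<longrightarrow> X \<noteq> {} \<longrightarrow> Y \<subseteq> {..<n} \<longrightarrow> Y \<noteq> {} \<longrightarrow>
        r \<le> set_dist pos X Y \<longrightarrow> acts_on n X A \<longrightarrow> acts_on n Y B \<longrightarrow>
        cmod (trace (\<rho> * A * B) - trace (\<rho> * A) * trace (\<rho> * B))
          \<le> op_norm A * op_norm B * exp (- set_dist pos X Y / \<xi>))"

end

theory Submission
  imports Defs "HOL-Analysis.L2_Norm" "HOL-Library.FuncSet"
begin

text \<open>Let \<open>W\<close> be the observable minus its canonical mean and \<open>x = \<beta> E + ln Z\<close>. For a normalized
  eigenvector \<open>\<psi>\<close> of energy \<open>E\<close> one has \<open>exp (- \<beta> E) |\<psi>\<rangle>\<langle>\<psi>| \<le> exp (- \<beta> H)\<close>, whence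
  \<open>|\<langle>\<psi>|W|\<psi>\<rangle>|\<^sup>2\<^sup>k \<le> \<langle>\<psi>|W\<^sup>2\<^sup>k|\<psi>\<rangle> \<le> exp x * tr (\<rho> W\<^sup>2\<^sup>k)\<close>, and likewise for every ground state, since
  \<open>E \<ge> 0\<close>. The choice \<open>k = \<lceil>x\<rceil>\<close> reduces the theorem to a bound of order
  \<open>(n k max l k ^ d)\<^sup>k\<close> on the moment.

  Expand \<open>W\<^sup>2\<^sup>k\<close> into words in the centred local terms. A word with a letter at distance more than
  \<open>2 l + s\<close> from all others contributes at most \<open>4\<^sup>k exp (- s / \<xi>)\<close> by clustering. In the other words
  each letter is close to another one, so at most \<open>k\<close> letters dominate the word, and there are at most
  of order \<open>(n k (l + s) ^ d)\<^sup>k\<close> such words. Summing over \<open>s\<close> gives the moment bound.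

  For small \<open>x\<close> the rounding \<open>k = \<lceil>x\<rceil>\<close> would be too lossy, but \<open>x \<ge> ln 2\<close> unless \<open>\<psi>\<close> is the unique
  ground state, where both sides of the difference agree.\<close>

text \<open>\<open>H\<close> is never diagonalised. With \<open>S\<close> the exponential at half
  the inverse temperature, exp (- \<beta> H) = S * S, and \<open>S\<close> scales every eigenvector
  of \<open>H\<close> by a known factor. Traces against exp (- \<beta> H) thus become squared
  Hilbert-Schmidt norms, which Bessel's inequality bounds from below by any orthonormal family at
  hand: one eigenvector for the operator inequality, two for the threshold ln 2. In the same spirit,
  the power inequality for \<open>W\<close> rests on log-convexity of the norms of W^k psi, not on a
  spectral measure.

  A choice of k at least x makes the prefactor exp x harmless, as its k-th root is at most e; a
  larger k would only inflate the moment.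

  The delicate point is the sum over s: the ball volume enters to the power k, so its growth in s
  must not cost more than a constant to the power k. Half of the decay, spread evenly over the d * k
  length factors, replaces l + s by a length of order l + k. This is how max l k arises; k <= l
  leads to the second term of the bound and k > l to the first, whose exponent (d + 1) / 2 comes
  from k * k^d under the root.

  Both expectations are measured from the same canonical mean, which cancels at the cost of a factor
  2.\<close>

section \<open>Coordinate sums, norms and self-adjointness\<close>

lemma mult_mat_entry:
  assumes "A \<in> carrier_mat N N" "B \<in> carrier_mat N N" "i < N" "j < N"
  shows "(A * B) $$ (i, j) = (\<Sum>k<N. A $$ (i, k) * B $$ (k, j))"
  using assms by (auto simp: scalar_prod_def lessThan_atLeast0 intro!: sum.cong)

lemma mult_mat_vec_entry:
  assumes "A \<in> carrier_mat N N" "v \<in> carrier_vec N" "i < N"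
  shows "(A *\<^sub>v v) $ i = (\<Sum>j<N. A $$ (i, j) * v $ j)"
  using assms by (auto simp: scalar_prod_def lessThan_atLeast0 intro!: sum.cong)

declare index_mult_mat(1) [simp del] index_mult_mat_vec [simp del]

lemma smult_mat_mult_vec:
  fixes c :: complex
  assumes "A \<in> carrier_mat N N" "v \<in> carrier_vec N"
  shows "(c \<cdot>\<^sub>m A) *\<^sub>v v = c \<cdot>\<^sub>v (A *\<^sub>v v)"
  using assms by (intro eq_vecI) (auto simp: mult_mat_vec_entry[where N=N] sum_distrib_left mult.assoc)

lemma cinner_sum:
  fixes v w :: "complex vec"
  assumes "w \<in> carrier_vec N"
  shows "v \<bullet>c w = (\<Sum>i<N. v $ i * cnj (w $ i))"
  using assms by (auto simp: scalar_prod_def lessThan_atLeast0 intro!: sum.cong)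

lemma cinner_self:
  fixes v :: "complex vec"
  assumes "v \<in> carrier_vec N"
  shows "v \<bullet>c v = of_real (\<Sum>i<N. (cmod (v $ i))\<^sup>2)"
  by (simp only: cinner_sum[OF assms] complex_norm_square of_real_sum)

lemma vnorm_L2_set:
  assumes "v \<in> carrier_vec N"
  shows "vnorm v = L2_set (\<lambda>i. cmod (v $ i)) {..<N}"
  by (simp only: vnorm_def cinner_self[OF assms] L2_set_def Re_complex_of_real)

lemma vnorm_nonneg [simp]: "v \<in> carrier_vec N \<Longrightarrow> 0 \<le> vnorm v"
  by (simp add: vnorm_L2_set L2_set_nonneg)

lemma vnorm_square:
  assumes "v \<in> carrier_vec N"
  shows "(vnorm v)\<^sup>2 = (\<Sum>i<N. (cmod (v $ i))\<^sup>2)" and "v \<bullet>c v = of_real ((vnorm v)\<^sup>2)"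
  by (simp_all add: vnorm_L2_set[OF assms] L2_set_def sum_nonneg cinner_self[OF assms])

lemma vnorm_smult:
  assumes "v \<in> carrier_vec N"
  shows "vnorm (c \<cdot>\<^sub>v v) = cmod c * vnorm v"
proof -
  have "vnorm (c \<cdot>\<^sub>v v) = L2_set (\<lambda>i. cmod c * cmod (v $ i)) {..<N}"
    using assms by (subst vnorm_L2_set[where N = N])
      (auto simp: norm_mult intro!: L2_set_cong)
  then show ?thesis
    by (simp add: vnorm_L2_set[OF assms] L2_set_right_distrib)
qed

lemma vnorm_add_le:
  assumes "v \<in> carrier_vec N" "w \<in> carrier_vec N"
  shows "vnorm (v + w) \<le> vnorm v + vnorm w"
proof -
  have "vnorm (v + w) = L2_set (\<lambda>i. cmod (v $ i + w $ i)) {..<N}"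
    using assms by (subst vnorm_L2_set[where N = N]) (auto intro!: L2_set_cong)
  also have "\<dots> \<le> L2_set (\<lambda>i. cmod (v $ i) + cmod (w $ i)) {..<N}"
    by (intro L2_set_mono) (auto intro: norm_triangle_ineq)
  also have "\<dots> \<le> vnorm v + vnorm w"
    unfolding vnorm_L2_set[OF assms(1)] vnorm_L2_set[OF assms(2)] by (rule L2_set_triangle_ineq)
  finally show ?thesis .
qed

lemma cmod_sum_mult_le:
  "cmod (\<Sum>i\<in>A. f i * g i) \<le> L2_set (\<lambda>i. cmod (f i)) A * L2_set (\<lambda>i. cmod (g i)) A"
proof -
  have "cmod (\<Sum>i\<in>A. f i * g i) \<le> (\<Sum>i\<in>A. \<bar>cmod (f i)\<bar> * \<bar>cmod (g i)\<bar>)"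
    by (rule order_trans[OF norm_sum]) (simp add: norm_mult)
  then show ?thesis
    using L2_set_mult_ineq[of "\<lambda>i. cmod (f i)" "\<lambda>i. cmod (g i)" A] by linarith
qed

lemma cauchy_schwarz:
  assumes "v \<in> carrier_vec N" "w \<in> carrier_vec N"
  shows "cmod (v \<bullet>c w) \<le> vnorm v * vnorm w"
  using cmod_sum_mult_le[of "\<lambda>i. v $ i" "\<lambda>i. cnj (w $ i)" "{..<N}"]
  by (simp add: cinner_sum[OF assms(2)] vnorm_L2_set[OF assms(1)] vnorm_L2_set[OF assms(2)])

lemma self_adjoint_iff:
  assumes "A \<in> carrier_mat N N"
  shows "self_adjoint A \<longleftrightarrow> (\<forall>i<N. \<forall>j<N. A $$ (i, j) = cnj (A $$ (j, i)))"
proof -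
  have 1: "mat_adjoint A $$ (i, j) = cnj (A $$ (j, i))" if "i < N" "j < N" for i j
    using assms that by (simp add: mat_adjoint_def mat_of_rows_index)
  have 2: "mat_adjoint A \<in> carrier_mat N N"
    using assms by (auto simp: mat_adjoint_def)
  have "mat_adjoint A = A \<longleftrightarrow> (\<forall>i<N. \<forall>j<N. mat_adjoint A $$ (i, j) = A $$ (i, j))"
    using 2 assms by (auto intro!: eq_matI)
  also have "\<dots> \<longleftrightarrow> (\<forall>i<N. \<forall>j<N. A $$ (i, j) = cnj (A $$ (j, i)))"
    using 1 by metis
  finally show ?thesis
    using assms by (auto simp: self_adjoint_def)
qed

lemma self_adjoint_entry:
  "\<lbrakk>self_adjoint A; A \<in> carrier_mat N N; i < N; j < N\<rbrakk> \<Longrightarrow> A $$ (i, j) = cnj (A $$ (j, i))"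
  using self_adjoint_iff by blast

lemma self_adjoint_cinner:
  assumes "self_adjoint A" "A \<in> carrier_mat N N" "v \<in> carrier_vec N" "w \<in> carrier_vec N"
  shows "(A *\<^sub>v v) \<bullet>c w = v \<bullet>c (A *\<^sub>v w)"
proof -
  have "(A *\<^sub>v v) \<bullet>c w = (\<Sum>i<N. \<Sum>j<N. A $$ (i, j) * v $ j * cnj (w $ i))"
    using assms(2-4) by (simp add: cinner_sum[where N=N] mult_mat_vec_entry[where N=N] sum_distrib_right)
  also have "\<dots> = (\<Sum>j<N. \<Sum>i<N. A $$ (i, j) * v $ j * cnj (w $ i))"
    by (rule sum.swap)
  also have "\<dots> = (\<Sum>j<N. v $ j * cnj (\<Sum>i<N. A $$ (j, i) * w $ i))"
    using self_adjoint_entry[OF assms(1,2), symmetric]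
    by (auto simp: sum_distrib_left mult_ac intro!: sum.cong)
  also have "\<dots> = v \<bullet>c (A *\<^sub>v w)"
    using assms(2-4) by (simp add: cinner_sum[where N=N] mult_mat_vec_entry[where N=N])
  finally show ?thesis .
qed

subsection \<open>Bounded operators\<close>

text \<open>An upper bound on the operator norm as a predicate composes along sums and products
  without touching a supremum. \<open>op_norm\<close> itself is met only where the local terms enter
  and where clustering is applied.\<close>

definition op_bounded :: "nat \<Rightarrow> complex mat \<Rightarrow> real \<Rightarrow> bool" where
  "op_bounded N A c \<longleftrightarrow> A \<in> carrier_mat N N \<and> (\<forall>v\<in>carrier_vec N. vnorm (A *\<^sub>v v) \<le> c * vnorm v)"

lemma op_bounded_carrier: "op_bounded N A c \<Longrightarrow> A \<in> carrier_mat N N"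
  by (simp add: op_bounded_def)

lemma vnorm_mult_le:
  assumes "M \<in> carrier_mat N N" "v \<in> carrier_vec N"
  shows "vnorm (M *\<^sub>v v) \<le> (\<Sum>i<N. \<Sum>j<N. cmod (M $$ (i, j))) * vnorm v"
proof -
  have "vnorm (M *\<^sub>v v) \<le> (\<Sum>i<N. cmod ((M *\<^sub>v v) $ i))"
    using assms by (subst vnorm_L2_set[where N=N]) (auto intro!: L2_set_le_sum )
  also have "\<dots> \<le> (\<Sum>i<N. \<Sum>j<N. cmod (M $$ (i, j)) * vnorm v)"
  proof (intro sum_mono)
    fix i assume "i \<in> {..<N}"
    have "cmod ((M *\<^sub>v v) $ i) \<le> (\<Sum>j<N. cmod (M $$ (i, j)) * cmod (v $ j))"
      using \<open>i \<in> _\<close> assms by (simp add: mult_mat_vec_entry[where N=N])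
        (rule order_trans[OF norm_sum], simp add: norm_mult)
    also have "\<dots> \<le> (\<Sum>j<N. cmod (M $$ (i, j)) * vnorm v)"
      using assms by (intro sum_mono mult_left_mono)
        (auto simp: vnorm_L2_set[where N=N] intro: member_le_L2_set)
    finally show "cmod ((M *\<^sub>v v) $ i) \<le> (\<Sum>j<N. cmod (M $$ (i, j)) * vnorm v)" .
  qed
  finally show ?thesis by (simp add: sum_distrib_right)
qed

lemma op_bounded_op_norm:
  assumes A: "A \<in> carrier_mat N N"
  shows "op_bounded N A (op_norm A)"
  unfolding op_bounded_def
proof (intro conjI A ballI)
  fix v :: "complex vec" assume v: "v \<in> carrier_vec N"
  define K where "K = (\<Sum>i<N. \<Sum>j<N. cmod (A $$ (i, j)))"
  \<comment> \<open>A real supremum says something only about a set that is bounded above; the crude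
    sum of all entry moduli provides such a bound.\<close>
  have bdd: "bdd_above ((\<lambda>v. vnorm (A *\<^sub>v v)) ` {v \<in> carrier_vec (dim_col A). vnorm v = 1})"
    using A by (intro bdd_aboveI[where M = K]) (auto simp: K_def dest: vnorm_mult_le[OF A])
  show "vnorm (A *\<^sub>v v) \<le> op_norm A * vnorm v"
  proof (cases "vnorm v = 0")
    case True
    then show ?thesis using vnorm_mult_le[OF A v] by simp
  next
    case False
    then have pos: "0 < vnorm v" using vnorm_nonneg[OF v] by linarith
    define u where "u = complex_of_real (1 / vnorm v) \<cdot>\<^sub>v v"
    have u: "u \<in> carrier_vec N" "vnorm u = 1"
      using v pos by (auto simp: u_def vnorm_smult[OF v] norm_divide)
    have "vnorm (A *\<^sub>v u) \<le> op_norm A"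
      unfolding op_norm_def using u A by (intro cSUP_upper bdd) auto
    moreover have "A *\<^sub>v u = complex_of_real (1 / vnorm v) \<cdot>\<^sub>v (A *\<^sub>v v)"
      using A v unfolding u_def by (simp add: mult_mat_vec)
    moreover have "A *\<^sub>v v \<in> carrier_vec N" using A v by simp
    ultimately show ?thesis
      using pos by (simp add: vnorm_smult[where N=N] norm_divide field_simps)
  qed
qed

lemma vnorm_unit_vec: "0 < N \<Longrightarrow> vnorm (unit_vec N 0) = 1"
proof -
  assume "0 < N"
  have "vnorm (unit_vec N 0) = sqrt (\<Sum>i<N. if i = 0 then 1 else 0)"
    by (subst vnorm_L2_set[where N=N])
      (auto simp: L2_set_def unit_vec_def intro!: arg_cong[where f=sqrt] sum.cong simp del: sum.delta sum.delta')
  then show ?thesis using \<open>0 < N\<close> by (simp add: sum.delta)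
qed

lemma op_norm_le:
  assumes "op_bounded N A c" "0 < N"
  shows "op_norm A \<le> c"
proof -
  have A: "A \<in> carrier_mat N N" using assms(1) by (rule op_bounded_carrier)
  \<comment> \<open>The supremum needs a unit vector to range over, hence the positive
    dimension.\<close>
  have "unit_vec N 0 \<in> {v \<in> carrier_vec (dim_col A). vnorm v = 1}"
    using A vnorm_unit_vec[OF assms(2)] by auto
  then show ?thesis
    unfolding op_norm_def using assms(1) A
    by (intro cSUP_least) (blast, auto simp: op_bounded_def)
qed

lemma op_bounded_nonneg:
  assumes "op_bounded N A c" "0 < N"
  shows "0 \<le> c"
proof -
  have "0 \<le> vnorm (A *\<^sub>v unit_vec N 0)"
    using op_bounded_carrier[OF assms(1)] by (intro vnorm_nonneg[where N=N]) auto
  also have "\<dots> \<le> c" 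
    using assms vnorm_unit_vec[of N] by (auto simp: op_bounded_def dest: bspec[of _ _ "unit_vec N 0"])
  finally show ?thesis .
qed

lemma op_bounded_mono:
  assumes "op_bounded N A c" "c \<le> c'"
  shows "op_bounded N A c'"
  using assms unfolding op_bounded_def
  by (meson mult_right_mono order_trans vnorm_nonneg)

lemma op_bounded_mult:
  assumes "op_bounded N A a" "op_bounded N B b" "0 < N"
  shows "op_bounded N (A * B) (a * b)"
  unfolding op_bounded_def
proof (intro conjI ballI)
  have A: "A \<in> carrier_mat N N" and B: "B \<in> carrier_mat N N"
    using assms by (auto dest: op_bounded_carrier)
  then show "A * B \<in> carrier_mat N N" by simp
  fix v :: "complex vec" assume v: "v \<in> carrier_vec N"
  have "vnorm (A * B *\<^sub>v v) = vnorm (A *\<^sub>v (B *\<^sub>v v))"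
    using A B v by (simp add: assoc_mult_mat_vec)
  also have "\<dots> \<le> a * vnorm (B *\<^sub>v v)"
    using assms(1) B v by (simp add: op_bounded_def)
  also have "\<dots> \<le> a * (b * vnorm v)"
    using assms(2) v op_bounded_nonneg[OF assms(1,3)]
    by (intro mult_left_mono) (auto simp: op_bounded_def)
  finally show "vnorm (A * B *\<^sub>v v) \<le> a * b * vnorm v" by simp
qed

lemma op_bounded_add_scalar:
  assumes "op_bounded N A a" "cmod c \<le> b"
  shows "op_bounded N (A + c \<cdot>\<^sub>m 1\<^sub>m N) (a + b)"
  unfolding op_bounded_def
proof (intro conjI ballI)
  have A: "A \<in> carrier_mat N N" using assms by (auto dest: op_bounded_carrier)
  then show "A + c \<cdot>\<^sub>m 1\<^sub>m N \<in> carrier_mat N N" by simp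
  fix v :: "complex vec" assume v: "v \<in> carrier_vec N"
  have cv: "(c \<cdot>\<^sub>m 1\<^sub>m N) *\<^sub>v v = c \<cdot>\<^sub>v v"
    using v by (simp add: smult_mat_mult_vec[where N=N])
  have "(A + c \<cdot>\<^sub>m 1\<^sub>m N) *\<^sub>v v = A *\<^sub>v v + c \<cdot>\<^sub>v v"
    using A v by (simp add: add_mult_distrib_mat_vec[where nr=N and nc=N] cv)
  then have "vnorm ((A + c \<cdot>\<^sub>m 1\<^sub>m N) *\<^sub>v v) \<le> vnorm (A *\<^sub>v v) + cmod c * vnorm v"
    using vnorm_add_le[of "A *\<^sub>v v" N "c \<cdot>\<^sub>v v"] A v by (simp add: vnorm_smult[OF v])
  also have "\<dots> \<le> a * vnorm v + b * vnorm v"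
    using assms v by (intro add_mono mult_right_mono) (auto simp: op_bounded_def)
  finally show "vnorm ((A + c \<cdot>\<^sub>m 1\<^sub>m N) *\<^sub>v v) \<le> (a + b) * vnorm v"
    by (simp add: algebra_simps)
qed

lemma op_bounded_one: "op_bounded N (1\<^sub>m N) 1"
  by (simp add: op_bounded_def)

subsection \<open>The exponential of a matrix\<close>

text \<open>The sum of all entry moduli dominates every column sum, so each further factor
  \<open>A\<close> costs at most this sum. Comparison with the scalar exponential series then gives
  absolute convergence.\<close>

lemma pow_mat_entry_le:
  assumes A: "A \<in> carrier_mat N N" and "i < N" "j < N"
  shows "cmod ((A ^\<^sub>m k) $$ (i, j)) \<le> (\<Sum>a<N. \<Sum>b<N. cmod (A $$ (a, b))) ^ k"
  using assms(2,3)
proof (induction k arbitrary: i j)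
  case 0
  then show ?case using A by simp
next
  case (Suc k)
  define K where "K = (\<Sum>a<N. \<Sum>b<N. cmod (A $$ (a, b)))"
  have K0: "0 \<le> K" unfolding K_def by (intro sum_nonneg) simp
  have col: "(\<Sum>a<N. cmod (A $$ (a, j))) \<le> K"
    unfolding K_def using Suc.prems by (intro sum_mono member_le_sum) auto
  have "(A ^\<^sub>m Suc k) $$ (i, j) = (\<Sum>a<N. (A ^\<^sub>m k) $$ (i, a) * A $$ (a, j))"
    using A Suc.prems by (simp add: mult_mat_entry[where N=N])
  also have "cmod \<dots> \<le> (\<Sum>a<N. K ^ k * cmod (A $$ (a, j)))"
    using Suc by (intro order_trans[OF norm_sum] sum_mono) (auto simp: norm_mult K_def intro!: mult_right_mono)
  also have "\<dots> \<le> K ^ k * K"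
    using col K0 by (simp add: sum_distrib_left[symmetric] mult_left_mono)
  finally show ?case by (simp add: K_def mult.commute)
qed

lemma mat_exp_summable:
  fixes A :: "complex mat"
  assumes A: "A \<in> carrier_mat N N" and "i < N" "j < N"
  shows "summable (\<lambda>k. norm ((A ^\<^sub>m k) $$ (i, j) / fact k))"
proof (rule summable_comparison_test')
  show "summable (\<lambda>k. inverse (fact k) * (\<Sum>a<N. \<Sum>b<N. cmod (A $$ (a, b))) ^ k)"
    by (rule summable_exp)
  show "norm (norm ((A ^\<^sub>m k) $$ (i, j) / fact k))
      \<le> inverse (fact k) * (\<Sum>a<N. \<Sum>b<N. cmod (A $$ (a, b))) ^ k" for k
    using pow_mat_entry_le[OF assms, of k] by (simp add: norm_divide field_simps)
qed

lemma mat_exp_carrier [simp]: "A \<in> carrier_mat N N \<Longrightarrow> mat_exp A \<in> carrier_mat N N"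
  by (simp add: mat_exp_def)

lemma mat_exp_sums:
  assumes A: "A \<in> carrier_mat N N" and "i < N" "j < N"
  shows "(\<lambda>k. (A ^\<^sub>m k) $$ (i, j) / fact k) sums (mat_exp A $$ (i, j))"
  using summable_sums[OF summable_norm_cancel[OF mat_exp_summable[OF assms]]] assms
  by (simp add: mat_exp_def)

lemma pow_mat_add:
  assumes A: "A \<in> carrier_mat N N"
  shows "A ^\<^sub>m (k + l) = A ^\<^sub>m k * A ^\<^sub>m l"
proof (induction l)
  case (Suc l)
  then show ?case using A by (simp add: assoc_mult_mat[where n\<^sub>1=N and n\<^sub>2=N and n\<^sub>3=N and n\<^sub>4=N])
qed (use A in simp)

lemma smult_smult_mat:
  fixes A :: "complex mat"
  shows "a \<cdot>\<^sub>m (b \<cdot>\<^sub>m A) = (a * b) \<cdot>\<^sub>m A"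
  by (intro eq_matI) (auto simp: mult.assoc)

lemma pow_smult_mat:
  fixes c :: complex
  assumes A: "A \<in> carrier_mat N N"
  shows "(c \<cdot>\<^sub>m A) ^\<^sub>m k = c ^ k \<cdot>\<^sub>m (A ^\<^sub>m k)"
proof (induction k)
  case (Suc k)
  then show ?case using A
    by (simp add: mult_smult_distrib[where n=N and nr=N and nc=N]
        mult_smult_assoc_mat[where n=N and nr=N and nc=N] smult_smult_mat mult.commute)
qed (use A in auto)

text \<open>Cauchy product, entry by entry: powers of one matrix combine to the k-th power, whose
  coefficient is the sum of 1 / (p! (k - p)!), that is 2^k / k!. Doubling is the only case of the
  functional equation that a square root requires.\<close>

lemma mat_exp_double:
  assumes A: "A \<in> carrier_mat N N"
  shows "mat_exp A * mat_exp A = mat_exp (2 \<cdot>\<^sub>m A)"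
proof (rule eq_matI)
  show "dim_row (mat_exp A * mat_exp A) = dim_row (mat_exp (2 \<cdot>\<^sub>m A))"
    "dim_col (mat_exp A * mat_exp A) = dim_col (mat_exp (2 \<cdot>\<^sub>m A))"
    using A by (auto simp: mat_exp_def)
  fix i j assume "i < dim_row (mat_exp (2 \<cdot>\<^sub>m A))" "j < dim_col (mat_exp (2 \<cdot>\<^sub>m A))"
  then have ij: "i < N" "j < N" using A by (auto simp: mat_exp_def)
  have binom: "(\<Sum>p\<le>k. 1 / (fact p * fact (k - p))) = (2 ^ k / fact k :: complex)" for k
  proof -
    have "(\<Sum>p\<le>k. 1 / (fact p * fact (k - p)) :: complex) = (\<Sum>p\<le>k. of_nat (k choose p) / fact k)"
      by (intro sum.cong) (auto simp: binomial_fact)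
    also have "\<dots> = of_nat (\<Sum>p\<le>k. k choose p) / fact k"
      by (simp add: sum_divide_distrib)
    finally show ?thesis by (simp add: choose_row_sum)
  qed
  have "(\<lambda>k. \<Sum>l<N. \<Sum>p\<le>k. ((A ^\<^sub>m p) $$ (i, l) / fact p) * ((A ^\<^sub>m (k - p)) $$ (l, j) / fact (k - p)))
      sums (\<Sum>l<N. mat_exp A $$ (i, l) * mat_exp A $$ (l, j))"
    using Cauchy_product_sums[OF mat_exp_summable mat_exp_summable, of A N i _ A N _ j] A ij
    by (intro sums_sum) (simp add: sums_unique[OF mat_exp_sums, symmetric])
  also have "(\<lambda>k. \<Sum>l<N. \<Sum>p\<le>k. ((A ^\<^sub>m p) $$ (i, l) / fact p) * ((A ^\<^sub>m (k - p)) $$ (l, j) / fact (k - p)))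
      = (\<lambda>k. ((2 \<cdot>\<^sub>m A) ^\<^sub>m k) $$ (i, j) / fact k)"
  proof
    fix k
    have "(\<Sum>l<N. \<Sum>p\<le>k. ((A ^\<^sub>m p) $$ (i, l) / fact p) * ((A ^\<^sub>m (k - p)) $$ (l, j) / fact (k - p)))
      = (\<Sum>p\<le>k. (\<Sum>l<N. (A ^\<^sub>m p) $$ (i, l) * (A ^\<^sub>m (k - p)) $$ (l, j)) * (1 / (fact p * fact (k - p))))"
      by (subst sum.swap) (simp add: sum_divide_distrib)
    also have "\<dots> = (\<Sum>p\<le>k. (A ^\<^sub>m k) $$ (i, j) * (1 / (fact p * fact (k - p))))"
      using A ij by (intro sum.cong)
        (auto simp: mult_mat_entry[where N=N, symmetric] pow_mat_add[OF A, symmetric])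
    also have "\<dots> = (A ^\<^sub>m k) $$ (i, j) * (2 ^ k / fact k)"
      by (simp only: sum_distrib_left[symmetric] binom)
    finally show "(\<Sum>l<N. \<Sum>p\<le>k. ((A ^\<^sub>m p) $$ (i, l) / fact p) * ((A ^\<^sub>m (k - p)) $$ (l, j) / fact (k - p)))
      = ((2 \<cdot>\<^sub>m A) ^\<^sub>m k) $$ (i, j) / fact k"
      using A ij by (simp add: pow_smult_mat[OF A])
  qed
  finally have "(\<lambda>k. ((2 \<cdot>\<^sub>m A) ^\<^sub>m k) $$ (i, j) / fact k) sums ((mat_exp A * mat_exp A) $$ (i, j))"
    using A ij by (simp add: mult_mat_entry[where N=N])
  moreover have "(\<lambda>k. ((2 \<cdot>\<^sub>m A) ^\<^sub>m k) $$ (i, j) / fact k) sums (mat_exp (2 \<cdot>\<^sub>m A) $$ (i, j))"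
    using A ij by (intro mat_exp_sums) auto
  ultimately show "(mat_exp A * mat_exp A) $$ (i, j) = mat_exp (2 \<cdot>\<^sub>m A) $$ (i, j)"
    by (rule sums_unique2)
qed

lemma self_adjoint_pow:
  assumes A: "A \<in> carrier_mat N N" and "self_adjoint A"
  shows "self_adjoint (A ^\<^sub>m k)"
proof (induction k)
  case 0
  have "A ^\<^sub>m 0 = 1\<^sub>m N" using A by simp
  then show ?case by (subst self_adjoint_iff[where N=N]) auto
next
  case (Suc k)
  have eq: "A ^\<^sub>m Suc k = A * A ^\<^sub>m k"
    using pow_mat_add[OF A, of 1 k] A by simp
  have sa: "\<And>i j. i < N \<Longrightarrow> j < N \<Longrightarrow> cnj (A $$ (j, i)) = A $$ (i, j)"
    "\<And>i j. i < N \<Longrightarrow> j < N \<Longrightarrow> cnj ((A ^\<^sub>m k) $$ (j, i)) = (A ^\<^sub>m k) $$ (i, j)"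
    using self_adjoint_entry[OF assms(2,1), symmetric] self_adjoint_entry[OF Suc pow_carrier_mat[OF A], symmetric] by auto
  have "(A ^\<^sub>m k * A) $$ (i, j) = cnj ((A * A ^\<^sub>m k) $$ (j, i))" if "i < N" "j < N" for i j
    using A that sa by (simp add: mult_mat_entry[where N=N] mult.commute)
  then have "(A ^\<^sub>m Suc k) $$ (i, j) = cnj ((A ^\<^sub>m Suc k) $$ (j, i))" if "i < N" "j < N" for i j
    using that by (subst (2) eq) simp
  then show ?case using self_adjoint_iff[OF pow_carrier_mat[OF A]] by blast
qed

lemma self_adjoint_smult:
  assumes "A \<in> carrier_mat N N" "self_adjoint A"
  shows "self_adjoint (complex_of_real c \<cdot>\<^sub>m A)"
proof -
  have "\<And>i j. i < N \<Longrightarrow> j < N \<Longrightarrow> cnj (A $$ (j, i)) = A $$ (i, j)"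
    using self_adjoint_entry[OF assms(2,1), symmetric] by auto
  then show ?thesis
    using assms(1) by (subst self_adjoint_iff[where N=N]) auto
qed

lemma self_adjoint_mat_exp:
  assumes A: "A \<in> carrier_mat N N" and "self_adjoint A"
  shows "self_adjoint (mat_exp A)"
proof (subst self_adjoint_iff[where N=N]; intro allI impI mat_exp_carrier A)
  fix i j assume ij: "i < N" "j < N"
  have "cnj ((A ^\<^sub>m k) $$ (j, i)) = (A ^\<^sub>m k) $$ (i, j)" for k
    using self_adjoint_entry[OF self_adjoint_pow[OF assms] pow_carrier_mat[OF A] ij] by simp
  then have "(\<lambda>k. cnj ((A ^\<^sub>m k) $$ (j, i) / fact k)) sums (mat_exp A $$ (i, j))"
    using mat_exp_sums[OF A ij] by simp
  then show "mat_exp A $$ (i, j) = cnj (mat_exp A $$ (j, i))"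
    using sums_cnj[THEN iffD2, OF mat_exp_sums[OF A ij(2,1)]] by (rule sums_unique2)
qed

lemma pow_mat_eigen:
  fixes e :: complex
  assumes A: "A \<in> carrier_mat N N" and v: "v \<in> carrier_vec N" and "A *\<^sub>v v = e \<cdot>\<^sub>v v"
  shows "A ^\<^sub>m k *\<^sub>v v = e ^ k \<cdot>\<^sub>v v"
proof (induction k)
  case (Suc k)
  have "A ^\<^sub>m Suc k *\<^sub>v v = A ^\<^sub>m k *\<^sub>v (A *\<^sub>v v)"
    using A v by (simp add: assoc_mult_mat_vec[where n\<^sub>1=N and n\<^sub>2=N and n\<^sub>3=N])
  also have "\<dots> = e \<cdot>\<^sub>v (e ^ k \<cdot>\<^sub>v v)"
    using A v assms(3) Suc by (simp add: mult_mat_vec[where nr=N and nc=N])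
  finally show ?case by (simp add: smult_smult_assoc)
qed (use A v in auto)

lemma mat_exp_eigen:
  fixes e :: complex
  assumes A: "A \<in> carrier_mat N N" and v: "v \<in> carrier_vec N" and ev: "A *\<^sub>v v = e \<cdot>\<^sub>v v"
  shows "mat_exp A *\<^sub>v v = exp e \<cdot>\<^sub>v v"
proof (rule eq_vecI)
  show "dim_vec (mat_exp A *\<^sub>v v) = dim_vec (exp e \<cdot>\<^sub>v v)"
    using A v by (simp add: mat_exp_def)
  fix i assume "i < dim_vec (exp e \<cdot>\<^sub>v v)"
  then have i: "i < N" using v by simp
  have "(\<lambda>k. \<Sum>j<N. (A ^\<^sub>m k) $$ (i, j) / fact k * v $ j) sums (\<Sum>j<N. mat_exp A $$ (i, j) * v $ j)"
    using A i by (intro sums_sum sums_mult2 mat_exp_sums) auto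
  also have "(\<lambda>k. \<Sum>j<N. (A ^\<^sub>m k) $$ (i, j) / fact k * v $ j) = (\<lambda>k. (e ^ k /\<^sub>R fact k) * v $ i)"
  proof
    fix k
    have "(\<Sum>j<N. (A ^\<^sub>m k) $$ (i, j) * v $ j) = e ^ k * v $ i"
      using arg_cong[OF pow_mat_eigen[OF assms, of k], of "\<lambda>u. u $ i"] A v i
      by (simp add: mult_mat_vec_entry[where N=N])
    then show "(\<Sum>j<N. (A ^\<^sub>m k) $$ (i, j) / fact k * v $ j) = (e ^ k /\<^sub>R fact k) * v $ i"
      by (simp add: sum_divide_distrib[symmetric] scaleR_conv_of_real field_simps)
  qed
  finally have "(\<lambda>k. (e ^ k /\<^sub>R fact k) * v $ i) sums ((mat_exp A *\<^sub>v v) $ i)"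
    using A v i by (simp add: mult_mat_vec_entry[where N=N])
  moreover have "(\<lambda>k. (e ^ k /\<^sub>R fact k) * v $ i) sums (exp e * v $ i)"
    by (intro sums_mult2 exp_converges)
  ultimately show "(mat_exp A *\<^sub>v v) $ i = (exp e \<cdot>\<^sub>v v) $ i"
    using v i by (simp add: sums_unique2)
qed

text \<open>The root is the exponential at half the inverse temperature. A self-adjoint root
  expresses positivity of the Gibbs operator, and its known action on eigenvectors stands in for
  functional calculus.\<close>

lemma gibbs_square_root:
  assumes H: "H \<in> carrier_mat N N" and "self_adjoint H"
  obtains S where "S \<in> carrier_mat N N" "self_adjoint S"
    "mat_exp (complex_of_real (- \<beta>) \<cdot>\<^sub>m H) = S * S"
    "\<And>v E. v \<in> carrier_vec N \<Longrightarrow> H *\<^sub>v v = complex_of_real E \<cdot>\<^sub>v v \<Longrightarrow>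
       S *\<^sub>v v = complex_of_real (exp (- \<beta> * E / 2)) \<cdot>\<^sub>v v"
proof
  define A where "A = complex_of_real (- \<beta> / 2) \<cdot>\<^sub>m H"
  have A: "A \<in> carrier_mat N N" using H by (simp add: A_def)
  show "mat_exp A \<in> carrier_mat N N" using A by simp
  show "self_adjoint (mat_exp A)"
    using self_adjoint_smult[OF assms] by (intro self_adjoint_mat_exp[OF A]) (simp only: A_def)
  have "2 \<cdot>\<^sub>m A = complex_of_real (- \<beta>) \<cdot>\<^sub>m H"
    by (simp add: A_def smult_smult_mat)
  then show "mat_exp (complex_of_real (- \<beta>) \<cdot>\<^sub>m H) = mat_exp A * mat_exp A"
    using mat_exp_double[OF A] by simp
  fix v :: "complex vec" and E :: real
  assume v: "v \<in> carrier_vec N" and "H *\<^sub>v v = complex_of_real E \<cdot>\<^sub>v v"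
  then have "A *\<^sub>v v = complex_of_real (- \<beta> / 2) \<cdot>\<^sub>v (complex_of_real E \<cdot>\<^sub>v v)"
    using smult_mat_mult_vec[OF H v] by (simp add: A_def)
  then have "A *\<^sub>v v = complex_of_real (- \<beta> * E / 2) \<cdot>\<^sub>v v"
    by (simp add: smult_smult_assoc)
  then show "mat_exp A *\<^sub>v v = complex_of_real (exp (- \<beta> * E / 2)) \<cdot>\<^sub>v v"
    using mat_exp_eigen[OF A v, of "complex_of_real (- \<beta> * E / 2)"] by (simp only: exp_of_real)
qed

subsection \<open>Traces\<close>

lemma trace_mult:
  assumes "A \<in> carrier_mat N N" "B \<in> carrier_mat N N"
  shows "trace (A * B) = (\<Sum>i<N. \<Sum>j<N. A $$ (i, j) * B $$ (j, i))"
  using assms by (auto simp: trace_def mult_mat_entry[where N=N])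

lemma trace_comm:
  assumes "A \<in> carrier_mat N N" "B \<in> carrier_mat N N"
  shows "trace (A * B) = trace (B * A)"
  unfolding trace_mult[OF assms] trace_mult[OF assms(2,1)]
  by (subst sum.swap) (simp add: mult.commute)

text \<open>Conjugation transposes both factors, which leaves the double sum unchanged. Applied to
  the canonical state it makes the local means real, so that the centred terms stay
  self-adjoint.\<close>

lemma Im_trace_self_adjoint:
  assumes "A \<in> carrier_mat N N" "B \<in> carrier_mat N N" "self_adjoint A" "self_adjoint B"
  shows "Im (trace (A * B)) = 0"
proof -
  have "\<And>i j. i < N \<Longrightarrow> j < N \<Longrightarrow> cnj (A $$ (i, j)) = A $$ (j, i)"
    "\<And>i j. i < N \<Longrightarrow> j < N \<Longrightarrow> cnj (B $$ (i, j)) = B $$ (j, i)"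
    using self_adjoint_entry[OF assms(3,1), symmetric] self_adjoint_entry[OF assms(4,2), symmetric] by auto
  then have "cnj (trace (A * B)) = (\<Sum>i<N. \<Sum>j<N. A $$ (j, i) * B $$ (i, j))"
    by (simp add: trace_mult[OF assms(1,2)])
  also have "\<dots> = trace (A * B)"
    unfolding trace_mult[OF assms(1,2)] by (rule sum.swap)
  finally show ?thesis by (metis complex_cnj_cancel_iff complex_eq_iff cnj.simps(2) neg_equal_zero)
qed

text \<open>The squared Hilbert-Schmidt norm.\<close>

definition frob :: "nat \<Rightarrow> complex mat \<Rightarrow> real" where
  "frob N M = (\<Sum>i<N. \<Sum>j<N. (cmod (M $$ (i, j)))\<^sup>2)"

definition orthonormal :: "complex vec set \<Rightarrow> bool" where
  "orthonormal B \<longleftrightarrow> (\<forall>u\<in>B. \<forall>v\<in>B. u \<bullet>c v = (if u = v then 1 else 0))"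

lemma bessel:
  assumes "finite B" "B \<subseteq> carrier_vec N" "orthonormal B"
  shows "(\<Sum>\<phi>\<in>B. (cmod (\<Sum>j<N. f j * \<phi> $ j))\<^sup>2) \<le> (\<Sum>j<N. (cmod (f j))\<^sup>2)"
proof -
  define c where "c \<phi> = (\<Sum>j<N. f j * \<phi> $ j)" for \<phi> :: "complex vec"
  \<comment> \<open>\<open>p\<close> is the orthogonal projection of the conjugate of
    \<open>f\<close> onto the span of \<open>B\<close>. Its squared norm and its pairing with
    \<open>f\<close> both equal \<open>T\<close>, so Cauchy-Schwarz bounds \<open>T\<close> by the
    norm of \<open>f\<close> times sqrt T.\<close>
  define p where "p j = (\<Sum>\<phi>\<in>B. cnj (c \<phi>) * \<phi> $ j)" for j
  define T where "T = (\<Sum>\<phi>\<in>B. (cmod (c \<phi>))\<^sup>2)"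
  have T0: "0 \<le> T" unfolding T_def by (intro sum_nonneg) simp
  have "(\<Sum>j<N. f j * p j) = (\<Sum>\<phi>\<in>B. cnj (c \<phi>) * c \<phi>)"
    unfolding p_def c_def sum_distrib_left by (subst sum.swap) (simp add: mult_ac)
  then have fp: "(\<Sum>j<N. f j * p j) = of_real T"
    by (simp only: T_def of_real_sum complex_norm_square mult.commute)
  have "(\<Sum>j<N. p j * cnj (p j))
      = (\<Sum>j<N. \<Sum>\<phi>\<in>B. \<Sum>\<chi>\<in>B. cnj (c \<phi>) * c \<chi> * (\<phi> $ j * cnj (\<chi> $ j)))"
    unfolding p_def cnj_sum sum_product by (simp add: mult_ac)
  also have "\<dots> = (\<Sum>\<phi>\<in>B. \<Sum>\<chi>\<in>B. cnj (c \<phi>) * c \<chi> * (\<Sum>j<N. \<phi> $ j * cnj (\<chi> $ j)))"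
    unfolding sum_distrib_left by (subst sum.swap) (intro sum.cong refl, rule sum.swap)
  also have "\<dots> = (\<Sum>\<phi>\<in>B. \<Sum>\<chi>\<in>B. if \<phi> = \<chi> then cnj (c \<phi>) * c \<chi> else 0)"
    using assms(2,3) by (intro sum.cong refl)
      (auto simp: orthonormal_def cinner_sum[where N=N, symmetric] subset_iff)
  also have "\<dots> = (\<Sum>\<phi>\<in>B. c \<phi> * cnj (c \<phi>))"
    using assms(1) by (simp add: sum.delta' mult.commute)
  also have "\<dots> = of_real T"
    by (simp only: T_def of_real_sum complex_norm_square)
  finally have "of_real (\<Sum>j<N. (cmod (p j))\<^sup>2) = complex_of_real T"
    by (simp only: of_real_sum complex_norm_square)
  then have pp: "(\<Sum>j<N. (cmod (p j))\<^sup>2) = T"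
    by (simp only: of_real_eq_iff)
  have "T \<le> L2_set (\<lambda>j. cmod (f j)) {..<N} * sqrt T"
    using cmod_sum_mult_le[of f p "{..<N}"] T0 by (simp add: fp pp L2_set_def[of "\<lambda>j. cmod (p j)"])
  moreover have "sqrt T * sqrt T = T" using T0 by simp
  ultimately have le: "sqrt T * sqrt T \<le> L2_set (\<lambda>j. cmod (f j)) {..<N} * sqrt T" by linarith
  have "sqrt T \<le> L2_set (\<lambda>j. cmod (f j)) {..<N}"
  proof (cases "T = 0")
    case False
    then show ?thesis using T0 le by (intro mult_right_le_imp_le[OF le]) simp
  qed (simp add: L2_set_nonneg)
  then have "T \<le> (\<Sum>j<N. (cmod (f j))\<^sup>2)"
    by (simp add: L2_set_def)
  then show ?thesis by (simp add: T_def c_def)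
qed

text \<open>Bessel's inequality for each row of \<open>M\<close>, summed over the rows. The family
  may be incomplete, so no eigenbasis is called for.\<close>

lemma sum_vnorm_le_frob:
  assumes "finite B" "B \<subseteq> carrier_vec N" "orthonormal B" and M: "M \<in> carrier_mat N N"
  shows "(\<Sum>\<phi>\<in>B. (vnorm (M *\<^sub>v \<phi>))\<^sup>2) \<le> frob N M"
proof -
  have "(\<Sum>\<phi>\<in>B. (vnorm (M *\<^sub>v \<phi>))\<^sup>2)
      = (\<Sum>\<phi>\<in>B. \<Sum>i<N. (cmod (\<Sum>j<N. M $$ (i, j) * \<phi> $ j))\<^sup>2)"
  proof (intro sum.cong refl)
    fix \<phi> assume "\<phi> \<in> B"
    then have \<phi>: "\<phi> \<in> carrier_vec N" using assms(2) by auto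
    then have "M *\<^sub>v \<phi> \<in> carrier_vec N" using M by auto
    then show "(vnorm (M *\<^sub>v \<phi>))\<^sup>2 = (\<Sum>i<N. (cmod (\<Sum>j<N. M $$ (i, j) * \<phi> $ j))\<^sup>2)"
      using mult_mat_vec_entry[OF M \<phi>] by (simp add: vnorm_square)
  qed
  also have "\<dots> = (\<Sum>i<N. \<Sum>\<phi>\<in>B. (cmod (\<Sum>j<N. M $$ (i, j) * \<phi> $ j))\<^sup>2)"
    by (rule sum.swap)
  also have "\<dots> \<le> frob N M"
    unfolding frob_def by (intro sum_mono bessel assms)
  finally show ?thesis .
qed

lemma trace_square:
  assumes S: "S \<in> carrier_mat N N" and "self_adjoint S"
  shows "trace (S * S) = of_real (frob N S)"
proof -
  have "cnj (S $$ (i, j)) = S $$ (j, i)" if "i < N" "j < N" for i j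
    using that by (intro self_adjoint_entry[OF assms(2,1), symmetric])
  then show ?thesis
    unfolding trace_mult[OF S S] frob_def of_real_sum complex_norm_square
    by (intro sum.cong refl) simp
qed

text \<open>By cyclicity the trace is that of S A S, the sum over the columns s of \<open>S\<close>
  of the quadratic form of \<open>A\<close> at s; each summand is at most c times the squared norm
  of s. After division by the partition function, this bounds expectations in the canonical state by
  the operator norm.\<close>

lemma cmod_trace_square_mult_le:
  assumes S: "S \<in> carrier_mat N N" and "self_adjoint S" and "op_bounded N A c"
  shows "cmod (trace (S * S * A)) \<le> c * frob N S"
proof -
  have A: "A \<in> carrier_mat N N" by (rule op_bounded_carrier[OF assms(3)])
  have sa: "cnj (S $$ (i, j)) = S $$ (j, i)" if "i < N" "j < N" for i j
    using that by (intro self_adjoint_entry[OF assms(2,1), symmetric])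
  have "trace (S * S * A) = trace (S * (A * S))"
    using S A trace_comm[of "S" N "S * A"] by (simp add: assoc_mult_mat[where n\<^sub>1=N and n\<^sub>2=N and n\<^sub>3=N and n\<^sub>4=N])
  also have "\<dots> = (\<Sum>i<N. (A *\<^sub>v col S i) \<bullet>c (col S i))"
  proof -
    have "(\<Sum>j<N. S $$ (i, j) * (A * S) $$ (j, i)) = (A *\<^sub>v col S i) \<bullet>c (col S i)" if "i < N" for i
    proof -
      have "(A *\<^sub>v col S i) \<bullet>c (col S i) = (\<Sum>j<N. (A *\<^sub>v col S i) $ j * cnj (S $$ (j, i)))"
        using S that by (subst cinner_sum[where N=N]) (auto intro!: sum.cong)
      also have "\<dots> = (\<Sum>j<N. S $$ (i, j) * (A * S) $$ (j, i))"
        using S A that by (intro sum.cong refl)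
          (simp add: sa mult_mat_vec_entry[where N=N] mult_mat_entry[where N=N])
      finally show ?thesis by simp
    qed
    then show ?thesis using S A by (subst trace_mult[where N=N]) auto
  qed
  finally have "cmod (trace (S * S * A)) \<le> (\<Sum>i<N. cmod ((A *\<^sub>v col S i) \<bullet>c (col S i)))"
    by (simp add: norm_sum)
  also have "\<dots> \<le> (\<Sum>i<N. c * (vnorm (col S i))\<^sup>2)"
  proof (intro sum_mono)
    fix i assume "i \<in> {..<N}"
    have v: "col S i \<in> carrier_vec N" using S by auto
    have "cmod ((A *\<^sub>v col S i) \<bullet>c (col S i)) \<le> vnorm (A *\<^sub>v col S i) * vnorm (col S i)"
      using v A by (intro cauchy_schwarz[where N=N]) auto
    also have "\<dots> \<le> c * vnorm (col S i) * vnorm (col S i)"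
      using assms(3) v by (intro mult_right_mono) (auto simp: op_bounded_def)
    finally show "cmod ((A *\<^sub>v col S i) \<bullet>c (col S i)) \<le> c * (vnorm (col S i))\<^sup>2"
      by (simp add: power2_eq_square mult.assoc)
  qed
  also have "(\<Sum>i<N. c * (vnorm (col S i))\<^sup>2) = c * (\<Sum>i<N. \<Sum>j<N. (cmod (S $$ (j, i)))\<^sup>2)"
    using S unfolding sum_distrib_left[symmetric]
    by (intro arg_cong[where f="\<lambda>x. c * x"] sum.cong refl, subst vnorm_square[where N=N]) (auto intro!: sum.cong)
  also have "(\<Sum>i<N. \<Sum>j<N. (cmod (S $$ (j, i)))\<^sup>2) = frob N S"
    unfolding frob_def by (rule sum.swap)
  finally show ?thesis .
qed

text \<open>Cyclicity turns the trace into that of (K S) (S K). Since S K is the adjoint of K S,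
  this is the squared Hilbert-Schmidt norm of K S, and the single unit vector \<open>\<psi>\<close>
  bounds it from below.\<close>

lemma trace_square_square_ge:
  assumes S: "S \<in> carrier_mat N N" and saS: "self_adjoint S"
    and K: "K \<in> carrier_mat N N" and saK: "self_adjoint K"
    and \<psi>: "\<psi> \<in> carrier_vec N" "vnorm \<psi> = 1" and ev: "S *\<^sub>v \<psi> = complex_of_real s \<cdot>\<^sub>v \<psi>"
  shows "s\<^sup>2 * (vnorm (K *\<^sub>v \<psi>))\<^sup>2 \<le> Re (trace (S * S * (K * K)))"
proof -
  have sa: "cnj (S $$ (i, j)) = S $$ (j, i)" "cnj (K $$ (i, j)) = K $$ (j, i)" if "i < N" "j < N" for i j
    using that self_adjoint_entry[OF saS S, symmetric] self_adjoint_entry[OF saK K, symmetric] by auto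
  have "trace (S * S * (K * K)) = trace ((K * S) * (S * K))"
    using S K trace_comm[of "S * S * K" N K]
    by (simp add: assoc_mult_mat[where n\<^sub>1=N and n\<^sub>2=N and n\<^sub>3=N and n\<^sub>4=N])
  also have "\<dots> = (\<Sum>i<N. \<Sum>j<N. (K * S) $$ (i, j) * cnj ((K * S) $$ (i, j)))"
  proof -
    have "(S * K) $$ (j, i) = cnj ((K * S) $$ (i, j))" if "i < N" "j < N" for i j
    proof -
      have "(S * K) $$ (j, i) = (\<Sum>k<N. cnj (S $$ (k, j)) * cnj (K $$ (i, k)))"
        unfolding mult_mat_entry[OF S K that(2,1)] using that sa by (intro sum.cong refl) auto
      then show ?thesis
        using that by (simp add: mult_mat_entry[OF K S] mult.commute)
    qed
    then show ?thesis using S K by (subst trace_mult[where N=N]) auto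
  qed
  also have "\<dots> = of_real (frob N (K * S))"
    by (simp only: frob_def of_real_sum complex_norm_square)
  finally have tr: "Re (trace (S * S * (K * K))) = frob N (K * S)" by simp
  have "orthonormal {\<psi>}"
    using \<psi> vnorm_square(2)[OF \<psi>(1)] by (simp add: orthonormal_def)
  then have "(vnorm ((K * S) *\<^sub>v \<psi>))\<^sup>2 \<le> frob N (K * S)"
    using sum_vnorm_le_frob[of "{\<psi>}" N "K * S"] \<psi> S K by simp
  moreover have "(K * S) *\<^sub>v \<psi> = complex_of_real s \<cdot>\<^sub>v (K *\<^sub>v \<psi>)"
    using S K \<psi> ev by (simp add: assoc_mult_mat_vec[where n\<^sub>1=N and n\<^sub>2=N and n\<^sub>3=N] mult_mat_vec[where nr=N and nc=N])
  moreover have "K *\<^sub>v \<psi> \<in> carrier_vec N" using K \<psi> by auto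
  ultimately show ?thesis
    unfolding tr by (simp add: vnorm_smult[where N=N] power_mult_distrib)
qed

subsection \<open>Powers of a self-adjoint operator\<close>

text \<open>The norms \<open>a k\<close> form a log-convex sequence: move one factor
  \<open>W\<close> across the inner product and apply Cauchy-Schwarz. As \<open>a 0\<close> is 1,
  the successive ratios never fall below \<open>a 1\<close>.\<close>

lemma expect_power_le:
  assumes W: "W \<in> carrier_mat N N" and sa: "self_adjoint W"
    and \<psi>: "\<psi> \<in> carrier_vec N" "vnorm \<psi> = 1"
  shows "cmod (expect W \<psi>) ^ k \<le> vnorm (W ^\<^sub>m k *\<^sub>v \<psi>)"
proof -
  define a where "a k = vnorm (W ^\<^sub>m k *\<^sub>v \<psi>)" for k
  have car: "W ^\<^sub>m k *\<^sub>v \<psi> \<in> carrier_vec N" for k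
    using pow_carrier_mat[OF W] \<psi>(1) by (rule mult_mat_vec_carrier)
  have a_nonneg: "0 \<le> a k" for k unfolding a_def using car by (rule vnorm_nonneg)
  have W_pow: "W *\<^sub>v (W ^\<^sub>m k *\<^sub>v \<psi>) = W ^\<^sub>m (Suc k) *\<^sub>v \<psi>" for k
    using pow_mat_add[OF W, of 1 k] W \<psi>(1)
    by (simp add: assoc_mult_mat_vec[where n\<^sub>1=N and n\<^sub>2=N and n\<^sub>3=N, symmetric])
  have log_convex: "(a (Suc k))\<^sup>2 \<le> a k * a (Suc (Suc k))" for k
  proof -
    have "complex_of_real ((a (Suc k))\<^sup>2) = (W *\<^sub>v (W ^\<^sub>m k *\<^sub>v \<psi>)) \<bullet>c (W ^\<^sub>m Suc k *\<^sub>v \<psi>)"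
      unfolding a_def W_pow by (simp only: vnorm_square(2)[OF car])
    also have "\<dots> = (W ^\<^sub>m k *\<^sub>v \<psi>) \<bullet>c (W *\<^sub>v (W ^\<^sub>m Suc k *\<^sub>v \<psi>))"
      by (rule self_adjoint_cinner[OF sa W car car])
    also have "\<dots> = (W ^\<^sub>m k *\<^sub>v \<psi>) \<bullet>c (W ^\<^sub>m Suc (Suc k) *\<^sub>v \<psi>)"
      by (simp only: W_pow)
    finally have "cmod (complex_of_real ((a (Suc k))\<^sup>2)) \<le> a k * a (Suc (Suc k))"
      unfolding a_def by (simp only: cauchy_schwarz[OF car car])
    then show ?thesis by (simp only: norm_of_real abs_power2)
  qed
  have step: "a 1 * a k \<le> a (Suc k)" for k
  proof (induction k)
    case 0
    have "a 0 = 1" using W \<psi> by (simp add: a_def)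
    then show ?case by simp
  next
    case (Suc k)
    show ?case
    proof (cases "a k = 0")
      \<comment> \<open>No ratio can be formed here, but log-convexity makes the next norm vanish as
        well.\<close>
      case True
      then have "a (Suc k) = 0" using log_convex[of k] by simp
      then show ?thesis using a_nonneg by simp
    next
      case False
      then have pos: "0 < a k" using a_nonneg[of k] by simp
      have "a k * (a 1 * a (Suc k)) = (a 1 * a k) * a (Suc k)" by simp
      also have "\<dots> \<le> a (Suc k) * a (Suc k)" by (intro mult_right_mono Suc a_nonneg)
      also have "\<dots> \<le> a k * a (Suc (Suc k))" using log_convex[of k] by (simp add: power2_eq_square)
      finally show ?thesis using pos by simp
    qed
  qed
  have "a 1 ^ k \<le> a k" for k
  proof (induction k)
    case 0
    show ?case using W \<psi> by (simp add: a_def)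
  next
    case (Suc k)
    have "a 1 ^ Suc k \<le> a 1 * a k" using Suc a_nonneg by (simp add: mult_left_mono)
    then show ?case using step[of k] by linarith
  qed
  moreover have "cmod (expect W \<psi>) \<le> a 1"
    using cauchy_schwarz[of "W *\<^sub>v \<psi>" N \<psi>] W \<psi> by (simp add: expect_def a_def)
  ultimately show ?thesis
    unfolding a_def[symmetric] by (meson norm_ge_zero order_trans power_mono)
qed

subsection \<open>Operators acting on a set of sites\<close>

definition bits :: "nat \<Rightarrow> nat \<Rightarrow> nat set" where
  "bits n a = {i. i < n \<and> bit a i}"

lemma bits_bij_betw: "bij_betw (bits n) {..<2 ^ n} (Pow {..<n})"
proof -
  have high: "\<not> bit a i" if "a < 2 ^ n" "n \<le> i" for a i :: nat
  proof -
    have "a < 2 ^ i" using that by (meson less_le_trans one_le_numeral power_increasing)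
    then show ?thesis by (simp add: bit_iff_odd)
  qed
  have inj: "inj_on (bits n) {..<2 ^ n}"
  proof (rule inj_onI)
    fix a b :: nat assume "a \<in> {..<2 ^ n}" "b \<in> {..<2 ^ n}" "bits n a = bits n b"
    then have "bit a i = bit b i" for i
      using high[of a i] high[of b i] by (cases "i < n") (auto simp: bits_def set_eq_iff)
    then show "a = b" by (simp add: bit_eq_iff)
  qed
  moreover have "bits n ` {..<2 ^ n} = Pow {..<n}"
  proof (rule card_subset_eq)
    show "card (bits n ` {..<2 ^ n}) = card (Pow {..<n})"
      using inj by (simp add: card_image card_Pow)
  qed (auto simp: bits_def)
  ultimately show ?thesis by (simp add: bij_betw_def)
qed

text \<open>The kernel of \<open>f\<close> on \<open>X\<close> tensored with the identity elsewhere,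
  in the basis labelled by the set of sites in state 1. With this labelling, matrix products become
  sums over subsets of sites and the tensor structure becomes set algebra.\<close>

definition opfun :: "nat set \<Rightarrow> (nat set \<Rightarrow> nat set \<Rightarrow> complex) \<Rightarrow> nat set \<Rightarrow> nat set \<Rightarrow> complex" where
  "opfun X f S T = (if S - X = T - X then f (S \<inter> X) (T \<inter> X) else 0)"

lemma acts_on_iff:
  assumes "X \<subseteq> {..<n}"
  shows "acts_on n X A \<longleftrightarrow> A \<in> carrier_mat (2 ^ n) (2 ^ n) \<and>
    (\<exists>f. \<forall>a<2 ^ n. \<forall>b<2 ^ n. A $$ (a, b) = opfun X f (bits n a) (bits n b))"
proof -
  have 1: "(\<forall>i<n. i \<notin> X \<longrightarrow> bit a i = bit b i) \<longleftrightarrow> bits n a - X = bits n b - X" for a b :: nat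
    by (auto simp: bits_def)
  have 2: "{i \<in> X. bit a i} = bits n a \<inter> X" for a :: nat
    using assms by (auto simp: bits_def)
  show ?thesis unfolding acts_on_def opfun_def 1 2 by (rule refl)
qed

lemma acts_on_carrier: "acts_on n X A \<Longrightarrow> A \<in> carrier_mat (2 ^ n) (2 ^ n)"
  by (simp add: acts_on_def)

lemma mult_opfun:
  assumes A: "A \<in> carrier_mat (2 ^ n) (2 ^ n)" "\<And>a b. a < 2 ^ n \<Longrightarrow> b < 2 ^ n \<Longrightarrow> A $$ (a, b) = F (bits n a) (bits n b)"
    and B: "B \<in> carrier_mat (2 ^ n) (2 ^ n)" "\<And>a b. a < 2 ^ n \<Longrightarrow> b < 2 ^ n \<Longrightarrow> B $$ (a, b) = G (bits n a) (bits n b)"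
    and ab: "a < 2 ^ n" "b < 2 ^ n"
  shows "(A * B) $$ (a, b) = (\<Sum>C\<in>Pow {..<n}. F (bits n a) C * G C (bits n b))"
proof -
  have "(A * B) $$ (a, b) = (\<Sum>c<2 ^ n. F (bits n a) (bits n c) * G (bits n c) (bits n b))"
    using A B ab by (simp add: mult_mat_entry[where N="2 ^ n"])
  also have "\<dots> = (\<Sum>C\<in>Pow {..<n}. F (bits n a) C * G C (bits n b))"
    by (rule sum.reindex_bij_betw[OF bits_bij_betw])
  finally show ?thesis .
qed

lemma acts_on_mult:
  assumes X: "X \<subseteq> {..<n}" and A: "acts_on n X A" and B: "acts_on n X B"
  shows "acts_on n X (A * B)"
proof -
  obtain f where f: "\<And>a b. a < 2 ^ n \<Longrightarrow> b < 2 ^ n \<Longrightarrow> A $$ (a, b) = opfun X f (bits n a) (bits n b)"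
    using A acts_on_iff[OF X] by blast
  obtain g where g: "\<And>a b. a < 2 ^ n \<Longrightarrow> b < 2 ^ n \<Longrightarrow> B $$ (a, b) = opfun X g (bits n a) (bits n b)"
    using B acts_on_iff[OF X] by blast
  define h where "h S T = (\<Sum>D\<in>Pow X. f S D * g D T)" for S T
  have key: "(\<Sum>C\<in>Pow {..<n}. opfun X f S C * opfun X g C T) = opfun X h S T"
    if S: "S \<subseteq> {..<n}" for S T
  proof -
    \<comment> \<open>The first factor vanishes unless the intermediate configuration agrees with
      \<open>S\<close> outside \<open>X\<close>, so only its part \<open>D\<close> inside
      \<open>X\<close> remains free.\<close>
    have "(\<Sum>C\<in>Pow {..<n}. opfun X f S C * opfun X g C T)
      = (\<Sum>C\<in>(\<lambda>D. D \<union> (S - X)) ` Pow X. opfun X f S C * opfun X g C T)"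
    proof (rule sum.mono_neutral_right)
      show "(\<lambda>D. D \<union> (S - X)) ` Pow X \<subseteq> Pow {..<n}" using S X by auto
      show "\<forall>C\<in>Pow {..<n} - (\<lambda>D. D \<union> (S - X)) ` Pow X. opfun X f S C * opfun X g C T = 0"
      proof
        fix C assume C: "C \<in> Pow {..<n} - (\<lambda>D. D \<union> (S - X)) ` Pow X"
        have "S - X \<noteq> C - X"
        proof
          assume "S - X = C - X"
          then have "C = (C \<inter> X) \<union> (S - X)" by blast
          then show False using C by blast
        qed
        then show "opfun X f S C * opfun X g C T = 0" by (simp add: opfun_def)
      qed
    qed simp
    also have "\<dots> = (\<Sum>D\<in>Pow X. opfun X f S (D \<union> (S - X)) * opfun X g (D \<union> (S - X)) T)"
      by (intro sum.reindex_cong[where l="\<lambda>D. D \<union> (S - X)"] inj_onI) auto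
    also have "\<dots> = (\<Sum>D\<in>Pow X. if S - X = T - X then f (S \<inter> X) D * g D (T \<inter> X) else 0)"
    proof (intro sum.cong refl)
      fix D assume "D \<in> Pow X"
      then have D: "(D \<union> (S - X)) - X = S - X" "(D \<union> (S - X)) \<inter> X = D" by auto
      show "opfun X f S (D \<union> (S - X)) * opfun X g (D \<union> (S - X)) T
        = (if S - X = T - X then f (S \<inter> X) D * g D (T \<inter> X) else 0)"
        unfolding opfun_def D by simp
    qed
    also have "\<dots> = opfun X h S T" by (simp add: opfun_def h_def)
    finally show ?thesis .
  qed
  have "(A * B) $$ (a, b) = opfun X h (bits n a) (bits n b)" if "a < 2 ^ n" "b < 2 ^ n" for a b
    using mult_opfun[OF acts_on_carrier[OF A] f acts_on_carrier[OF B] g that]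
      key[of "bits n a" "bits n b"] by (auto simp: bits_def)
  then show ?thesis
    using acts_on_carrier[OF A] acts_on_carrier[OF B] acts_on_iff[OF X] by auto
qed

lemma acts_on_mono:
  assumes "X \<subseteq> Y" and Y: "Y \<subseteq> {..<n}" and A: "acts_on n X A"
  shows "acts_on n Y A"
proof -
  have X: "X \<subseteq> {..<n}" using assms by blast
  obtain f where f: "\<And>a b. a < 2 ^ n \<Longrightarrow> b < 2 ^ n \<Longrightarrow> A $$ (a, b) = opfun X f (bits n a) (bits n b)"
    using A acts_on_iff[OF X] by blast
  \<comment> \<open>The kernel on the larger set is \<open>opfun X f\<close> itself:
    \<open>f\<close> tensored with the identity on Y - X.\<close>
  have "opfun X f S T = opfun Y (opfun X f) S T" for S T
  proof -
    have "S - X = T - X \<longleftrightarrow> S - Y = T - Y \<and> (S \<inter> Y) - X = (T \<inter> Y) - X"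
      using assms(1) by blast
    moreover have "(S \<inter> Y) \<inter> X = S \<inter> X" "(T \<inter> Y) \<inter> X = T \<inter> X" using assms(1) by auto
    ultimately show ?thesis by (simp add: opfun_def)
  qed
  then show ?thesis
    using f acts_on_carrier[OF A] acts_on_iff[OF Y] by metis
qed

lemma acts_on_add_scalar:
  assumes X: "X \<subseteq> {..<n}" and A: "acts_on n X A"
  shows "acts_on n X (A + c \<cdot>\<^sub>m 1\<^sub>m (2 ^ n))"
proof -
  obtain f where f: "\<And>a b. a < 2 ^ n \<Longrightarrow> b < 2 ^ n \<Longrightarrow> A $$ (a, b) = opfun X f (bits n a) (bits n b)"
    using A acts_on_iff[OF X] by blast
  define g where "g S T = f S T + (if S = T then c else 0)" for S T
  have "(A + c \<cdot>\<^sub>m 1\<^sub>m (2 ^ n)) $$ (a, b) = opfun X g (bits n a) (bits n b)"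
    if "a < 2 ^ n" "b < 2 ^ n" for a b
  proof -
    have "a = b \<longleftrightarrow> bits n a = bits n b"
      using bits_bij_betw[of n] that unfolding bij_betw_def inj_on_def by auto
    also have "\<dots> \<longleftrightarrow> bits n a - X = bits n b - X \<and> bits n a \<inter> X = bits n b \<inter> X"
      by blast
    finally show ?thesis
      using that acts_on_carrier[OF A] by (simp add: f opfun_def g_def)
  qed
  then show ?thesis
    using acts_on_carrier[OF A] acts_on_iff[OF X] by auto
qed

lemma acts_on_one:
  assumes X: "X \<subseteq> {..<n}"
  shows "acts_on n X (1\<^sub>m (2 ^ n))"
proof -
  have "acts_on n X (0\<^sub>m (2 ^ n) (2 ^ n))"
    unfolding acts_on_iff[OF X] by (auto simp: opfun_def intro!: exI[of _ "\<lambda>_ _. 0"])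
  from acts_on_add_scalar[OF X this, of 1] have "acts_on n X (0\<^sub>m (2 ^ n) (2 ^ n) + 1 \<cdot>\<^sub>m 1\<^sub>m (2 ^ n))" .
  also have "0\<^sub>m (2 ^ n) (2 ^ n) + 1 \<cdot>\<^sub>m 1\<^sub>m (2 ^ n) = (1\<^sub>m (2 ^ n) :: complex mat)"
    by (rule eq_matI) auto
  finally show ?thesis .
qed

lemma acts_on_commute:
  assumes X: "X \<subseteq> {..<n}" and Y: "Y \<subseteq> {..<n}" and disj: "X \<inter> Y = {}"
    and A: "acts_on n X A" and B: "acts_on n Y B"
  shows "A * B = B * A"
proof -
  obtain f where f: "\<And>a b. a < 2 ^ n \<Longrightarrow> b < 2 ^ n \<Longrightarrow> A $$ (a, b) = opfun X f (bits n a) (bits n b)"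
    using A acts_on_iff[OF X] by blast
  obtain g where g: "\<And>a b. a < 2 ^ n \<Longrightarrow> b < 2 ^ n \<Longrightarrow> B $$ (a, b) = opfun Y g (bits n a) (bits n b)"
    using B acts_on_iff[OF Y] by blast
  have single: "(\<Sum>C\<in>Pow {..<n}. opfun X f S C * opfun Y g C T)
      = (if S - (X \<union> Y) = T - (X \<union> Y) then f (S \<inter> X) (T \<inter> X) * g (S \<inter> Y) (T \<inter> Y) else 0)"
    if "S \<subseteq> {..<n}" "T \<subseteq> {..<n}" and XY: "X \<inter> Y = {}" for S T X Y f g
  proof -
    \<comment> \<open>Exactly one intermediate configuration survives: it agrees with
      \<open>T\<close> on \<open>X\<close>, where the first factor has already acted, and with
      \<open>S\<close> elsewhere. The resulting value is symmetric under exchanging the two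
      operators, which is why \<open>single\<close> is stated for arbitrary sets and kernels and
      then used in both orders.\<close>
    let ?C = "(T \<inter> X) \<union> (S - X)"
    have "(\<Sum>C\<in>Pow {..<n}. opfun X f S C * opfun Y g C T) = (\<Sum>C\<in>{?C}. opfun X f S C * opfun Y g C T)"
    proof (rule sum.mono_neutral_right)
      show "\<forall>C\<in>Pow {..<n} - {?C}. opfun X f S C * opfun Y g C T = 0"
      proof
        fix C assume C: "C \<in> Pow {..<n} - {?C}"
        have "\<not> (S - X = C - X \<and> C - Y = T - Y)"
        proof
          assume h: "S - X = C - X \<and> C - Y = T - Y"
          have "C \<inter> X = T \<inter> X" using h XY by blast
          then have "C = ?C" using h by blast
          then show False using C by blast
        qed
        then show "opfun X f S C * opfun Y g C T = 0" by (auto simp: opfun_def)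
      qed
    qed (use that in auto)
    moreover have "S - X = ?C - X" "?C \<inter> X = T \<inter> X" "?C \<inter> Y = S \<inter> Y"
      "?C - Y = T - Y \<longleftrightarrow> S - (X \<union> Y) = T - (X \<union> Y)"
      using XY by blast+
    ultimately show ?thesis by (simp add: opfun_def)
  qed
  show ?thesis
  proof (rule eq_matI)
    fix a b assume "a < dim_row (B * A)" "b < dim_col (B * A)"
    then have ab: "a < 2 ^ n" "b < 2 ^ n"
      using acts_on_carrier[OF A] acts_on_carrier[OF B] by auto
    have sub: "bits n a \<subseteq> {..<n}" "bits n b \<subseteq> {..<n}" by (auto simp: bits_def)
    show "(A * B) $$ (a, b) = (B * A) $$ (a, b)"
      using mult_opfun[OF acts_on_carrier[OF A] f acts_on_carrier[OF B] g ab]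
        mult_opfun[OF acts_on_carrier[OF B] g acts_on_carrier[OF A] f ab]
        single[OF sub disj] single[OF sub, of Y X] disj
      by (simp add: Un_commute Int_commute mult.commute)
  qed (use acts_on_carrier[OF A] acts_on_carrier[OF B] in auto)
qed

subsection \<open>Counting words without isolated letters\<close>

text \<open>Ore's argument: the complement of a minimal dominating set is dominating as well, because
  a vertex of the set with all its neighbours inside the set could be removed.\<close>

lemma small_dominating_set:
  assumes fin: "finite J" and sym: "\<And>i j. E i j \<Longrightarrow> E j i" and irrefl: "\<And>i. \<not> E i i"
    and nbr: "\<And>j. j \<in> J \<Longrightarrow> \<exists>i\<in>J. E i j"
  obtains S where "S \<subseteq> J" "2 * card S \<le> card J" "\<And>j. j \<in> J - S \<Longrightarrow> \<exists>p\<in>S. E p j"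
proof -
  define dom where "dom S \<longleftrightarrow> S \<subseteq> J \<and> (\<forall>j\<in>J - S. \<exists>p\<in>S. E p j)" for S
  have "finite {S. dom S}"
    by (rule finite_subset[of _ "Pow J"]) (auto simp: dom_def fin)
  moreover have "dom J" by (simp add: dom_def)
  ultimately obtain S where S: "dom S" and min: "\<And>S'. dom S' \<Longrightarrow> S' \<subseteq> S \<Longrightarrow> S' = S"
    using finite_has_minimal[of "{S. dom S}"] by auto
  have "dom (J - S)"
    unfolding dom_def
  proof (intro conjI ballI)
    fix j assume "j \<in> J - (J - S)"
    then have j: "j \<in> J" "j \<in> S" by auto
    show "\<exists>p\<in>J - S. E p j"
    proof (rule ccontr)
      assume no: "\<not> (\<exists>p\<in>J - S. E p j)"
      have "dom (S - {j})"
        unfolding dom_def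
      proof (intro conjI ballI)
        show "S - {j} \<subseteq> J" using S by (auto simp: dom_def)
        fix i assume i: "i \<in> J - (S - {j})"
        show "\<exists>p\<in>S - {j}. E p i"
        proof (cases "i = j")
          case True
          then show ?thesis using nbr[OF j(1)] no irrefl by blast
        next
          case False
          then have "i \<in> J - S" using i by blast
          then show ?thesis using S no sym unfolding dom_def by blast
        qed
      qed
      then show False using min[of "S - {j}"] j by blast
    qed
  qed auto
  moreover have "card S + card (J - S) = card J"
    using S fin by (metis dom_def card_Diff_subset card_mono finite_subset le_add_diff_inverse)
  ultimately show thesis
    using that[of S] that[of "J - S"] S unfolding dom_def
    by (cases "2 * card S \<le> card J") auto
qed

text \<open>The letters at the positions in \<open>S\<close> are free. Every other letter lies in
  the union of at most \<open>card S\<close> neighbourhoods, whose size depends on the free letters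
  only through the uniform bound \<open>V\<close>; hence the dependent pairs in
  \<open>?P\<close>.\<close>

lemma card_dominated_words:
  fixes A :: "'a set"
  assumes fin: "finite A" and S: "S \<subseteq> {..<m}"
    and nbhd: "\<And>a. a \<in> A \<Longrightarrow> real (card {b \<in> A. R a b}) \<le> V" and V: "0 \<le> V"
  shows "real (card {t. set t \<subseteq> A \<and> length t = m \<and> (\<forall>j\<in>{..<m} - S. \<exists>p\<in>S. R (t ! p) (t ! j))})
    \<le> real (card A) ^ card S * (real (card S) * V) ^ (m - card S)"
proof -
  let ?T = "{t. set t \<subseteq> A \<and> length t = m \<and> (\<forall>j\<in>{..<m} - S. \<exists>p\<in>S. R (t ! p) (t ! j))}"
  let ?U = "\<lambda>u. \<Union>p\<in>S. {b \<in> A. R (u p) b}"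
  let ?P = "Sigma (S \<rightarrow>\<^sub>E A) (\<lambda>u. ({..<m} - S) \<rightarrow>\<^sub>E ?U u)"
  let ?f = "\<lambda>t. (restrict (\<lambda>j. t ! j) S, restrict (\<lambda>j. t ! j) ({..<m} - S))"
  have finS: "finite S" using S finite_subset by blast
  have inj: "inj_on ?f ?T"
  proof (rule inj_onI)
    fix t t' assume t: "t \<in> ?T" "t' \<in> ?T" and eq: "?f t = ?f t'"
    show "t = t'"
    proof (rule nth_equalityI)
      show "length t = length t'" using t by simp
      fix i assume "i < length t"
      then have "i \<in> S \<or> i \<in> {..<m} - S" using t by auto
      then show "t ! i = t' ! i"
        using eq by (metis (no_types, lifting) Pair_inject restrict_apply')
    qed
  qed
  have sub: "?f ` ?T \<subseteq> ?P"
  proof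
    fix z assume "z \<in> ?f ` ?T"
    then obtain t where t: "t \<in> ?T" and z: "z = ?f t" by blast
    have mem: "t ! j \<in> A" if "j < m" for j using t that nth_mem by blast
    have "restrict (\<lambda>j. t ! j) S \<in> S \<rightarrow>\<^sub>E A" using mem S by auto
    moreover have "restrict (\<lambda>j. t ! j) ({..<m} - S) \<in> ({..<m} - S) \<rightarrow>\<^sub>E ?U (restrict (\<lambda>j. t ! j) S)"
    proof (rule restrict_PiE_iff[THEN iffD2], intro ballI)
      fix j assume j: "j \<in> {..<m} - S"
      then obtain p where "p \<in> S" "R (t ! p) (t ! j)" using t by blast
      then show "t ! j \<in> ?U (restrict (\<lambda>j. t ! j) S)" using mem j by auto
    qed
    ultimately show "z \<in> ?P" using z by blast
  qed
  have finU: "finite (?U u)" for u using finS fin by auto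
  have finP: "finite ?P"
    using finS fin finU by (intro finite_SigmaI finite_PiE) auto
  have cardS: "card S \<le> m" using card_mono[OF _ S] by simp
  have cardU: "real (card (?U u)) \<le> real (card S) * V" if "u \<in> S \<rightarrow>\<^sub>E A" for u
  proof -
    have "real (card (?U u)) \<le> real (\<Sum>p\<in>S. card {b \<in> A. R (u p) b})"
      using card_UN_le[OF finS] of_nat_le_iff by blast
    also have "\<dots> \<le> (\<Sum>p\<in>S. V)"
      unfolding of_nat_sum using that by (intro sum_mono nbhd) auto
    finally show ?thesis by simp
  qed
  have "real (card ?T) \<le> real (card ?P)"
    using card_inj_on_le[OF inj sub finP] by simp
  also have "card ?P = (\<Sum>u\<in>S \<rightarrow>\<^sub>E A. card (({..<m} - S) \<rightarrow>\<^sub>E ?U u))"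
    using finS fin finU by (intro card_SigmaI ballI finite_PiE) auto
  also have "real \<dots> \<le> (\<Sum>u\<in>S \<rightarrow>\<^sub>E A. (real (card S) * V) ^ (m - card S))"
    unfolding of_nat_sum
  proof (rule sum_mono)
    fix u assume u: "u \<in> S \<rightarrow>\<^sub>E A"
    have "card (({..<m} - S) \<rightarrow>\<^sub>E ?U u) = card (?U u) ^ (m - card S)"
      using S finS by (simp add: card_PiE card_Diff_subset)
    then show "real (card (({..<m} - S) \<rightarrow>\<^sub>E ?U u)) \<le> (real (card S) * V) ^ (m - card S)"
      using power_mono[OF cardU[OF u], of "m - card S"] by simp
  qed
  also have "\<dots> = real (card A) ^ card S * (real (card S) * V) ^ (m - card S)"
    using finS by (simp add: card_PiE)
  finally show ?thesis .
qed

text \<open>Sum the count of dominated words over all dominating position sets with at most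
  \<open>k\<close> elements. Their size can drop below \<open>k\<close>, so the bounds have to be
  brought to a common form, for which the comparison of \<open>real k * V\<close> with the alphabet
  size decides.\<close>

lemma card_words_without_isolated:
  fixes A :: "'a set"
  assumes fin: "finite A" and sym: "\<And>a b. R a b \<Longrightarrow> R b a"
    and nbhd: "\<And>a. a \<in> A \<Longrightarrow> real (card {b \<in> A. R a b}) \<le> V" and V: "0 \<le> V"
  shows "real (card {t. set t \<subseteq> A \<and> length t = 2 * k \<and>
      (\<forall>j<2 * k. \<exists>i<2 * k. i \<noteq> j \<and> R (t ! i) (t ! j))})
    \<le> (4 * real (card A) * real k * V) ^ k"
proof -
  define n where "n = real (card A)"
  define T where "T = {t. set t \<subseteq> A \<and> length t = 2 * k \<and> (\<forall>j<2 * k. \<exists>i<2 * k. i \<noteq> j \<and> R (t ! i) (t ! j))}"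
  define D where "D S = {t. set t \<subseteq> A \<and> length t = 2 * k \<and> (\<forall>j\<in>{..<2 * k} - S. \<exists>p\<in>S. R (t ! p) (t ! j))}" for S
  have finL: "finite {t. set t \<subseteq> A \<and> length t = 2 * k}" using fin by (rule finite_lists_length_eq)
  have n0: "0 \<le> n" by (simp add: n_def)
  have "real (card T) \<le> (4 * (n * (real k * V))) ^ k"
  proof (cases "real k * V \<le> n")
    \<comment> \<open>Neighbourhoods this large make the count of all words of length 2 * k
      sufficient.\<close>
    case False
    have "real (card T) \<le> real (card {t. set t \<subseteq> A \<and> length t = 2 * k})"
      unfolding T_def using finL by (intro of_nat_mono card_mono) auto
    also have "\<dots> = n ^ (2 * k)" using fin by (simp add: card_lists_length_eq n_def)
    also have "\<dots> = (n * n) ^ k" by (simp add: power_mult power2_eq_square)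
    also have "\<dots> \<le> (4 * (n * (real k * V))) ^ k"
    proof (rule power_mono)
      have "n * n \<le> n * (real k * V)" using False n0 by (intro mult_left_mono) auto
      moreover have "0 \<le> n * n" by simp
      ultimately show "n * n \<le> 4 * (n * (real k * V))" by linarith
    qed simp
    finally show ?thesis .
  next
    case True
    let ?Ss = "{S. S \<subseteq> {..<2 * k} \<and> card S \<le> k}"
    have finSs: "finite ?Ss" by (rule finite_subset[of _ "Pow {..<2 * k}"]) auto
    have "T \<subseteq> (\<Union>S\<in>?Ss. D S)"
    proof
      fix t assume t: "t \<in> T"
      obtain S where S: "S \<subseteq> {..<2 * k}" "2 * card S \<le> card {..<2 * k}"
        "\<And>j. j \<in> {..<2 * k} - S \<Longrightarrow> \<exists>p\<in>S. p \<noteq> j \<and> R (t ! p) (t ! j)"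
        using t sym small_dominating_set[of "{..<2 * k}" "\<lambda>i j. i \<noteq> j \<and> R (t ! i) (t ! j)"]
        unfolding T_def by (smt (verit) finite_lessThan lessThan_iff mem_Collect_eq)
      have "S \<in> ?Ss" using S by simp
      moreover have "t \<in> D S" using t S(3) unfolding T_def D_def by blast
      ultimately
      show "t \<in> (\<Union>S\<in>?Ss. D S)" by blast
    qed
    moreover have finD: "finite (D S)" for S
      unfolding D_def by (rule finite_subset[OF _ finL]) auto
    ultimately have "card T \<le> card (\<Union>S\<in>?Ss. D S)"
      using finSs by (intro card_mono) auto
    also have "\<dots> \<le> (\<Sum>S\<in>?Ss. card (D S))" using finSs by (rule card_UN_le)
    finally have "real (card T) \<le> (\<Sum>S\<in>?Ss. real (card (D S)))"
      by (metis of_nat_le_iff of_nat_sum)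
    also have "\<dots> \<le> (\<Sum>S\<in>?Ss. (n * (real k * V)) ^ k)"
    proof (rule sum_mono)
      fix S assume "S \<in> ?Ss"
      then have S: "S \<subseteq> {..<2 * k}" "card S \<le> k" by auto
      have split: "2 * k - card S = (k - card S) + k" using S by simp
      have "real (card (D S)) \<le> n ^ card S * (real (card S) * V) ^ (2 * k - card S)"
        unfolding D_def n_def using fin S(1) nbhd V by (rule card_dominated_words)
      also have "\<dots> \<le> n ^ card S * (real k * V) ^ (2 * k - card S)"
        using S V n0 by (intro mult_left_mono power_mono mult_right_mono) auto
      also have "\<dots> = n ^ card S * ((real k * V) ^ (k - card S) * (real k * V) ^ k)"
        by (simp only: split power_add)
      \<comment> \<open>A dominating set smaller than \<open>k\<close> leaves surplus factors
        \<open>real k * V\<close>; in this case each of them is at most \<open>n\<close>.\<close>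
      also have "\<dots> \<le> n ^ card S * (n ^ (k - card S) * (real k * V) ^ k)"
        using True V n0 by (intro mult_left_mono mult_right_mono power_mono) auto
      also have "\<dots> = (n * (real k * V)) ^ k"
        using S by (simp add: power_mult_distrib power_add[symmetric] mult.assoc[symmetric])
      finally show "real (card (D S)) \<le> (n * (real k * V)) ^ k" .
    qed
    also have "\<dots> = real (card ?Ss) * (n * (real k * V)) ^ k" by simp
    \<comment> \<open>The constant 4 of the statement counts the subsets of the 2 * k
      positions.\<close>
    also have "\<dots> \<le> 4 ^ k * (n * (real k * V)) ^ k"
    proof (rule mult_right_mono)
      have "card ?Ss \<le> card (Pow {..<2 * k})" by (rule card_mono) auto
      also have "\<dots> = 4 ^ k" by (simp add: card_Pow power_mult)
      finally show "real (card ?Ss) \<le> 4 ^ k"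
        by (metis of_nat_le_iff of_nat_numeral of_nat_power)
      show "0 \<le> (n * (real k * V)) ^ k" using n0 V by simp
    qed
    finally show ?thesis by (simp add: power_mult_distrib)
  qed
  then show ?thesis by (simp add: T_def n_def mult.assoc)
qed

subsection \<open>Balls in the lattice\<close>

lemma manhattan_nonneg: "0 \<le> manhattan x y"
  unfolding manhattan_def by (intro sum_nonneg) simp

lemma manhattan_self [simp]: "manhattan x x = 0"
  by (simp add: manhattan_def)

lemma manhattan_commute: "length x = length y \<Longrightarrow> manhattan x y = manhattan y x"
  by (simp add: manhattan_def abs_minus_commute)

lemma manhattan_triangle:
  "length x = length y \<Longrightarrow> manhattan x z \<le> manhattan x y + manhattan y z"
  by (simp only: manhattan_def sum.distrib[symmetric]) (intro sum_mono, arith)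

lemma coordinate_le_manhattan:
  "k < length x \<Longrightarrow> \<bar>real (x ! k) - real (y ! k)\<bar> \<le> manhattan x y"
  unfolding manhattan_def by (rule member_le_sum) auto

lemma card_nat_interval:
  assumes "0 \<le> R"
  shows "finite {y::nat. \<bar>real x - real y\<bar> \<le> R}"
    and "real (card {y::nat. \<bar>real x - real y\<bar> \<le> R}) \<le> 2 * R + 1"
proof -
  define q where "q = nat \<lfloor>R\<rfloor>"
  have q: "real q \<le> R" using assms by (simp add: q_def)
  have sub: "{y::nat. \<bar>real x - real y\<bar> \<le> R} \<subseteq> {x - q..x + q}"
  proof
    fix y assume "y \<in> {y::nat. \<bar>real x - real y\<bar> \<le> R}"
    then have "real_of_int \<bar>int x - int y\<bar> \<le> R" by simp
    then have "\<bar>int x - int y\<bar> \<le> int q" using assms by (simp add: q_def le_floor_iff)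
    then show "y \<in> {x - q..x + q}" by auto
  qed
  show "finite {y::nat. \<bar>real x - real y\<bar> \<le> R}" by (rule finite_subset[OF sub]) simp
  have "card {y::nat. \<bar>real x - real y\<bar> \<le> R} \<le> card {x - q..x + q}"
    by (rule card_mono[OF _ sub]) simp
  also have "\<dots> \<le> 2 * q + 1" by auto
  finally show "real (card {y::nat. \<bar>real x - real y\<bar> \<le> R}) \<le> 2 * R + 1" using q by linarith
qed

text \<open>Each coordinate of a point of the ball lies in an interval of radius \<open>R\<close>,
  so the ball embeds into a cube. This is the only place where the dimension enters the
  geometry.\<close>

lemma card_site_ball_le:
  assumes inj: "inj_on pos {..<n}" and len: "\<And>j. j < n \<Longrightarrow> length (pos j) = d"
    and "i < n" "0 \<le> R"
  shows "real (card (site_ball n pos i R)) \<le> (2 * R + 1) ^ d"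
proof -
  let ?I = "\<lambda>k. {y::nat. \<bar>real (pos i ! k) - real y\<bar> \<le> R}"
  let ?f = "\<lambda>j. restrict (\<lambda>k. pos j ! k) {..<d}"
  have "inj_on ?f (site_ball n pos i R)"
  proof (rule inj_onI)
    fix j j' assume j: "j \<in> site_ball n pos i R" "j' \<in> site_ball n pos i R" and eq: "?f j = ?f j'"
    have "pos j = pos j'"
    proof (rule nth_equalityI)
      show "length (pos j) = length (pos j')" using j len by (simp add: site_ball_def)
      fix k assume "k < length (pos j)"
      then have "k < d" using j len by (simp add: site_ball_def)
      then show "pos j ! k = pos j' ! k" using fun_cong[OF eq, of k] by simp
    qed
    then show "j = j'" using inj j by (auto simp: site_ball_def inj_on_def)
  qed
  moreover have "?f ` site_ball n pos i R \<subseteq> PiE {..<d} ?I"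
  proof
    fix g assume "g \<in> ?f ` site_ball n pos i R"
    then obtain j where j: "j \<in> site_ball n pos i R" and g: "g = ?f j" by blast
    have "\<bar>real (pos i ! k) - real (pos j ! k)\<bar> \<le> R" if "k < d" for k
      using coordinate_le_manhattan[of k "pos i" "pos j"] j that len[OF \<open>i < n\<close>]
      by (simp add: site_ball_def)
    then show "g \<in> PiE {..<d} ?I" unfolding g by auto
  qed
  moreover have "finite (PiE {..<d} ?I)"
    using card_nat_interval(1)[OF \<open>0 \<le> R\<close>] by (intro finite_PiE) auto
  ultimately have "card (site_ball n pos i R) \<le> card (PiE {..<d} ?I)"
    by (intro card_inj_on_le) auto
  then have "real (card (site_ball n pos i R)) \<le> (\<Prod>k<d. real (card (?I k)))"
    unfolding of_nat_prod[symmetric] of_nat_le_iff by (simp only: card_PiE[OF finite_lessThan])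
  also have "\<dots> \<le> (\<Prod>k<d. 2 * R + 1)"
    using card_nat_interval(2)[OF \<open>0 \<le> R\<close>] by (intro prod_mono) auto
  finally show ?thesis by simp
qed

subsection \<open>Words in local operators\<close>

fun word :: "nat \<Rightarrow> (nat \<Rightarrow> complex mat) \<Rightarrow> nat list \<Rightarrow> complex mat" where
  "word N h [] = 1\<^sub>m N"
| "word N h (i # t) = h i * word N h t"

lemma word_carrier:
  "(\<And>i. i \<in> set t \<Longrightarrow> h i \<in> carrier_mat N N) \<Longrightarrow> word N h t \<in> carrier_mat N N"
  by (induction t) (auto intro: mult_carrier_mat[of _ N N])

lemma word_append:
  assumes "\<And>i. i \<in> set (u @ v) \<Longrightarrow> h i \<in> carrier_mat N N"
  shows "word N h (u @ v) = word N h u * word N h v"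
  using assms
proof (induction u)
  case Nil
  then have "word N h v \<in> carrier_mat N N" by (intro word_carrier) auto
  then show ?case by simp
next
  case (Cons i u)
  have "h i \<in> carrier_mat N N" "word N h u \<in> carrier_mat N N" "word N h v \<in> carrier_mat N N"
    using Cons.prems by (auto intro: word_carrier)
  then show ?case using Cons
    by (simp add: assoc_mult_mat[where n\<^sub>1=N and n\<^sub>2=N and n\<^sub>3=N and n\<^sub>4=N])
qed

lemma op_bounded_word:
  assumes "\<And>i. i \<in> set t \<Longrightarrow> op_bounded N (h i) c" "0 < N"
  shows "op_bounded N (word N h t) (c ^ length t)"
  using assms(1) by (induction t) (auto intro: op_bounded_one op_bounded_mult assms(2))

lemma acts_on_word:
  assumes "Y \<subseteq> {..<n}" "\<And>i. i \<in> set t \<Longrightarrow> acts_on n Y (h i)"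
  shows "acts_on n Y (word (2 ^ n) h t)"
  using assms(2) by (induction t) (auto intro: acts_on_one[OF assms(1)] acts_on_mult[OF assms(1)])

lemma site_sum_carrier [simp]: "site_sum n h \<in> carrier_mat (2 ^ n) (2 ^ n)"
  by (simp add: site_sum_def)

lemma site_sum_pow_entry:
  assumes h: "\<And>i. i < n \<Longrightarrow> h i \<in> carrier_mat (2 ^ n) (2 ^ n)" and "a < 2 ^ n" "b < 2 ^ n"
  shows "(site_sum n h ^\<^sub>m k) $$ (a, b) =
    (\<Sum>t | set t \<subseteq> {..<n} \<and> length t = k. word (2 ^ n) h t $$ (a, b))"
  using assms(2)
proof (induction k arbitrary: a)
  case 0
  have "{t :: nat list. set t \<subseteq> {..<n} \<and> length t = 0} = {[]}" by auto
  then show ?case by (simp add: site_sum_def)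
next
  case (Suc k)
  let ?L = "\<lambda>k. {t. set t \<subseteq> {..<n} \<and> length t = k}"
  have "(site_sum n h ^\<^sub>m Suc k) $$ (a, b) = (site_sum n h * site_sum n h ^\<^sub>m k) $$ (a, b)"
    using pow_mat_add[OF site_sum_carrier, of n h 1 k] by simp
  also have "\<dots> = (\<Sum>c<2 ^ n. (\<Sum>i<n. h i $$ (a, c)) * (\<Sum>t\<in>?L k. word (2 ^ n) h t $$ (c, b)))"
    using Suc \<open>b < 2 ^ n\<close> by (subst mult_mat_entry[where N="2 ^ n"]) (auto simp: site_sum_def)
  also have "\<dots> = (\<Sum>c<2 ^ n. \<Sum>i<n. \<Sum>t\<in>?L k. h i $$ (a, c) * word (2 ^ n) h t $$ (c, b))"
    by (simp only: sum_product)
  also have "\<dots> = (\<Sum>i<n. \<Sum>c<2 ^ n. \<Sum>t\<in>?L k. h i $$ (a, c) * word (2 ^ n) h t $$ (c, b))"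
    by (rule sum.swap)
  also have "\<dots> = (\<Sum>i<n. \<Sum>t\<in>?L k. \<Sum>c<2 ^ n. h i $$ (a, c) * word (2 ^ n) h t $$ (c, b))"
    by (intro sum.cong refl sum.swap)
  also have "\<dots> = (\<Sum>i<n. \<Sum>t\<in>?L k. word (2 ^ n) h (i # t) $$ (a, b))"
    using Suc.prems \<open>b < 2 ^ n\<close> h
    by (intro sum.cong refl) (auto simp: subset_iff intro!: mult_mat_entry[symmetric] word_carrier)
  also have "\<dots> = (\<Sum>(i, t)\<in>{..<n} \<times> ?L k. word (2 ^ n) h (i # t) $$ (a, b))"
    by (rule sum.cartesian_product)
  also have "\<dots> = (\<Sum>t\<in>?L (Suc k). word (2 ^ n) h t $$ (a, b))"
  proof (rule sum.reindex_cong[symmetric, where l="\<lambda>(i, t). i # t"])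
    show "inj_on (\<lambda>(i, t). i # t) ({..<n} \<times> ?L k)" by (auto simp: inj_on_def)
    show "?L (Suc k) = (\<lambda>(i, t). i # t) ` ({..<n} \<times> ?L k)"
      by (auto simp: length_Suc_conv image_iff)
  qed auto
  finally show ?case .
qed

lemma trace_mult_site_sum_pow:
  assumes h: "\<And>i. i < n \<Longrightarrow> h i \<in> carrier_mat (2 ^ n) (2 ^ n)"
    and \<rho>: "\<rho> \<in> carrier_mat (2 ^ n) (2 ^ n)"
  shows "trace (\<rho> * site_sum n h ^\<^sub>m k) =
    (\<Sum>t | set t \<subseteq> {..<n} \<and> length t = k. trace (\<rho> * word (2 ^ n) h t))"
proof -
  let ?L = "{t. set t \<subseteq> {..<n} \<and> length t = k}"
  have w: "word (2 ^ n) h t \<in> carrier_mat (2 ^ n) (2 ^ n)" if "t \<in> ?L" for t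
    using that h by (auto intro!: word_carrier)
  have "trace (\<rho> * site_sum n h ^\<^sub>m k)
      = (\<Sum>a<2 ^ n. \<Sum>b<2 ^ n. \<Sum>t\<in>?L. \<rho> $$ (a, b) * word (2 ^ n) h t $$ (b, a))"
    unfolding trace_mult[OF \<rho> pow_carrier_mat[OF site_sum_carrier]]
    by (intro sum.cong refl) (simp add: site_sum_pow_entry[OF h] sum_distrib_left)
  also have "\<dots> = (\<Sum>a<2 ^ n. \<Sum>t\<in>?L. \<Sum>b<2 ^ n. \<rho> $$ (a, b) * word (2 ^ n) h t $$ (b, a))"
    by (intro sum.cong refl sum.swap)
  also have "\<dots> = (\<Sum>t\<in>?L. \<Sum>a<2 ^ n. \<Sum>b<2 ^ n. \<rho> $$ (a, b) * word (2 ^ n) h t $$ (b, a))"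
    by (rule sum.swap)
  also have "\<dots> = (\<Sum>t\<in>?L. trace (\<rho> * word (2 ^ n) h t))"
    by (intro sum.cong refl) (simp only: trace_mult[OF \<rho> w])
  finally show ?thesis .
qed

subsection \<open>Moments of a centred observable in a clustering state\<close>

text \<open>For the moment bound, the canonical state is reduced to two properties: expectations do
  not exceed the operator norm, and correlations cluster. The bound 2 on a letter is 1 for the local
  term plus at most 1 for its subtracted mean.\<close>

locale centred_observable =
  fixes n d :: nat and pos :: "nat \<Rightarrow> nat list" and r \<xi> l :: real
    and \<rho> :: "complex mat" and h :: "nat \<Rightarrow> complex mat"
  assumes d: "1 \<le> d" and r: "0 < r" and \<xi>: "0 < \<xi>" and rl: "r \<le> l"
    and inj: "inj_on pos {..<n}" and len: "\<And>j. j < n \<Longrightarrow> length (pos j) = d"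
    and \<rho>: "\<rho> \<in> carrier_mat (2 ^ n) (2 ^ n)"
    and state: "\<And>A c. op_bounded (2 ^ n) A c \<Longrightarrow> cmod (trace (\<rho> * A)) \<le> c"
    and clust: "clustering n pos r \<xi> \<rho>"
    and acts: "\<And>i. i < n \<Longrightarrow> acts_on n (site_ball n pos i l) (h i)"
    and bounded: "\<And>i. i < n \<Longrightarrow> op_bounded (2 ^ n) (h i) 2"
    and centred: "\<And>i. i < n \<Longrightarrow> trace (\<rho> * h i) = 0"
begin

lemma h_carrier: "i < n \<Longrightarrow> h i \<in> carrier_mat (2 ^ n) (2 ^ n)"
  using acts acts_on_carrier by blast

lemma ball_subset: "site_ball n pos i l \<subseteq> {..<n}"
  by (auto simp: site_ball_def)

lemma word_bound:
  assumes "set t \<subseteq> {..<n}"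
  shows "cmod (trace (\<rho> * word (2 ^ n) h t)) \<le> 2 ^ length t"
  using assms bounded by (intro state op_bounded_word) auto

text \<open>An isolated letter commutes with the rest of the word, so it can be moved to the front, where
  clustering and the vanishing mean of the letter make the trace small.\<close>

lemma word_isolated_bound:
  assumes t: "set t \<subseteq> {..<n}" "2 \<le> length t" and j: "j < length t"
    and iso: "\<And>i. i < length t \<Longrightarrow> i \<noteq> j \<Longrightarrow> 2 * l + s < manhattan (pos (t ! i)) (pos (t ! j))"
    and s: "r \<le> s"
  shows "cmod (trace (\<rho> * word (2 ^ n) h t)) \<le> 2 ^ length t * exp (- s / \<xi>)"
proof -
  let ?N = "2 ^ n :: nat"
  define u v a where "u = take j t" and "v = drop (Suc j) t" and "a = t ! j"
  have t_eq: "t = u @ a # v" using j by (simp add: u_def v_def a_def id_take_nth_drop)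
  have sets: "set u \<subseteq> {..<n}" "set v \<subseteq> {..<n}" "a < n" using t(1) by (auto simp: t_eq)
  have ne: "u @ v \<noteq> []" using t(2) by (auto simp: t_eq)
  define X where "X = site_ball n pos a l"
  define Y where "Y = (\<Union>b\<in>set (u @ v). site_ball n pos b l)"
  have XY: "X \<subseteq> {..<n}" "Y \<subseteq> {..<n}" using ball_subset by (auto simp: X_def Y_def)
  \<comment> \<open>The radius is positive because it is at least \<open>r\<close>. So the supports
    contain their centres and are nonempty, as clustering demands.\<close>
  have self: "i \<in> site_ball n pos i l" if "i < n" for i using that r rl by (simp add: site_ball_def)
  have Xne: "X \<noteq> {}" using self[OF sets(3)] by (auto simp: X_def)
  have Yne: "Y \<noteq> {}"
  proof -
    obtain b where b: "b \<in> set (u @ v)" using ne by (cases "u @ v") auto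
    then have "b < n" using sets by auto
    then show ?thesis using self b unfolding Y_def by blast
  qed
  have far: "2 * l + s < manhattan (pos b) (pos a)" if b: "b \<in> set (u @ v)" for b
  proof -
    obtain i where "i < length t" "i \<noteq> j" "b = t ! i"
    proof (cases "b \<in> set u")
      case True
      then obtain i where "i < length u" "b = u ! i" by (auto simp: in_set_conv_nth)
      then show thesis using that[of i] by (auto simp: u_def)
    next
      case False
      then obtain i where "i < length v" "b = v ! i" using b by (auto simp: in_set_conv_nth)
      then show thesis using that[of "Suc j + i"] by (auto simp: v_def)
    qed
    then show ?thesis using iso by (simp add: a_def)
  qed
  have dist: "s \<le> manhattan (pos x) (pos y)" if xy: "x \<in> X" "y \<in> Y" for x y
  proof -
    obtain b where b: "b \<in> set (u @ v)" "y \<in> site_ball n pos b l" using xy(2) by (auto simp: Y_def)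
    have x: "x < n" "manhattan (pos a) (pos x) \<le> l" using xy(1) by (auto simp: X_def site_ball_def)
    have y: "y < n" "manhattan (pos b) (pos y) \<le> l" using b(2) by (auto simp: site_ball_def)
    have bn: "b < n" using b(1) sets by auto
    have "manhattan (pos b) (pos a) \<le> manhattan (pos b) (pos y) + manhattan (pos y) (pos a)"
      using len bn y(1) by (intro manhattan_triangle) simp
    also have "manhattan (pos y) (pos a) \<le> manhattan (pos y) (pos x) + manhattan (pos x) (pos a)"
      using len x(1) y(1) by (intro manhattan_triangle) simp
    finally show ?thesis
      using far[OF b(1)] x y len sets(3) by (simp add: manhattan_commute[of "pos y"] manhattan_commute[of "pos x" "pos a"])
  qed
  have "finite X" "finite Y" using XY finite_subset by blast+
  then have sd: "s \<le> set_dist pos X Y"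
    unfolding set_dist_def using Xne Yne dist by (intro Min.boundedI) auto
  \<comment> \<open>A common site would be at distance 0 from itself, below the positive
    \<open>s\<close>.\<close>
  have disj: "X \<inter> Y = {}" using dist[of x x for x] r s by fastforce
  have car: "h i \<in> carrier_mat ?N ?N" if "i \<in> set t" for i using that t(1) h_carrier by auto
  have Wc: "word ?N h u \<in> carrier_mat ?N ?N" "word ?N h v \<in> carrier_mat ?N ?N" "h a \<in> carrier_mat ?N ?N"
    using car by (auto intro!: word_carrier simp: t_eq)
  have actsX: "acts_on n X (h a)" unfolding X_def using sets(3) by (rule acts)
  \<comment> \<open>Two subwords are of interest: \<open>u\<close> for the commutation and
    \<open>u @ v\<close> for the clustering bound.\<close>
  have actsY: "acts_on n Y (word ?N h w)" if "set w \<subseteq> set (u @ v)" for w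
  proof (rule acts_on_word[OF XY(2)])
    fix i assume "i \<in> set w"
    then have i: "i \<in> set (u @ v)" using that by blast
    then have "i < n" using sets by auto
    then show "acts_on n Y (h i)"
      using i by (intro acts_on_mono[OF _ XY(2) acts]) (auto simp: Y_def)
  qed
  define B where "B = word ?N h (u @ v)"
  have B: "B \<in> carrier_mat ?N ?N" unfolding B_def using car by (intro word_carrier) (auto simp: t_eq)
  have "word ?N h t = word ?N h u * (h a * word ?N h v)"
    using car word_append[of u "a # v" h ?N] by (simp add: t_eq)
  also have "\<dots> = (word ?N h u * h a) * word ?N h v"
    using Wc by (simp add: assoc_mult_mat[where n\<^sub>1="?N" and n\<^sub>2="?N" and n\<^sub>3="?N" and n\<^sub>4="?N"])
  also have "word ?N h u * h a = h a * word ?N h u"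
    using acts_on_commute[OF XY disj actsX actsY[of u]] by simp
  also have "(h a * word ?N h u) * word ?N h v = h a * B"
    using Wc car word_append[of u v h ?N] by (simp add: B_def t_eq assoc_mult_mat[where n\<^sub>1="?N" and n\<^sub>2="?N" and n\<^sub>3="?N" and n\<^sub>4="?N"])
  finally have "\<rho> * word ?N h t = \<rho> * h a * B"
    using Wc B \<rho> by (simp add: assoc_mult_mat[where n\<^sub>1="?N" and n\<^sub>2="?N" and n\<^sub>3="?N" and n\<^sub>4="?N"])
  moreover have "cmod (trace (\<rho> * h a * B) - trace (\<rho> * h a) * trace (\<rho> * B))
      \<le> op_norm (h a) * op_norm B * exp (- set_dist pos X Y / \<xi>)"
    using clust XY Xne Yne sd s actsX actsY[of "u @ v"] unfolding clustering_def B_def by auto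
  ultimately have "cmod (trace (\<rho> * word ?N h t)) \<le> op_norm (h a) * op_norm B * exp (- set_dist pos X Y / \<xi>)"
    using centred[OF sets(3)] by simp
  also have "\<dots> \<le> (2 * 2 ^ length (u @ v)) * exp (- s / \<xi>)"
  proof (intro mult_mono)
    show "op_norm (h a) \<le> 2" using bounded[OF sets(3)] by (rule op_norm_le) simp
    show "op_norm B \<le> 2 ^ length (u @ v)"
    proof (rule op_norm_le[where N="?N"])
      show "op_bounded ?N B (2 ^ length (u @ v))"
        unfolding B_def using sets bounded by (intro op_bounded_word) auto
    qed simp
    show "0 \<le> op_norm B" using op_bounded_op_norm[OF B] by (rule op_bounded_nonneg) simp
    show "exp (- set_dist pos X Y / \<xi>) \<le> exp (- s / \<xi>)" using sd \<xi> by (simp add: divide_right_mono)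
  qed auto
  also have "2 * 2 ^ length (u @ v) = (2 ^ length t :: real)" by (simp add: t_eq)
  finally show ?thesis .
qed

end

section \<open>Constants of the moment bound, and decay against volume growth\<close>

text \<open>The numerator makes the estimate trivial for scales up to r + 1 and pays for stepping
  back by one scale beyond them. The denominator is that of the geometric series of the remaining
  half of the decay.\<close>

definition moment_const :: "real \<Rightarrow> real \<Rightarrow> real" where
  "moment_const r \<xi> = exp ((r + 1) / \<xi>) / (1 - exp (- 1 / (2 * \<xi>)))"

text \<open>One summand for each part of the length 4 l + 1 + 4 \<xi> d k, measured in units of max
  l k; the middle one uses 1 <= l / r.\<close>

definition length_const :: "nat \<Rightarrow> real \<Rightarrow> real \<Rightarrow> real" where
  "length_const d r \<xi> = 4 + 1 / r + 4 * \<xi> * real d"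

lemma exp_minus_less_one: "0 < \<xi> \<Longrightarrow> exp (- 1 / (2 * \<xi>)) < (1::real)"
  by simp

lemma moment_const_ge_one:
  assumes "0 < r" "0 < \<xi>"
  shows "1 \<le> moment_const r \<xi>"
proof -
  have "1 - exp (- 1 / (2 * \<xi>)) \<le> 1" by simp
  also have "1 \<le> exp ((r + 1) / \<xi>)" using assms by simp
  finally show ?thesis
    unfolding moment_const_def using exp_minus_less_one[OF assms(2)] by (subst le_divide_eq_1_pos) auto
qed

text \<open>Half of the exponential decay pays for the growth of the ball volume, because
  \<open>y * exp (- y) \<le> 1\<close>.\<close>

lemma decay_times_volume_le:
  fixes s k d :: nat
  assumes d: "1 \<le> d" and k: "1 \<le> k" and r: "0 < r" and \<xi>: "0 < \<xi>" and rl: "r \<le> l"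
  shows "exp (- real s / \<xi>) * ((4 * l + 2 * real s + 1) ^ d) ^ k
    \<le> exp (- real s / (2 * \<xi>)) * ((length_const d r \<xi> * max l (real k)) ^ d) ^ k"
proof -
  define p where "p = d * k"
  have p: "0 < p" using d k by (simp add: p_def)
  \<comment> \<open>Chosen so that half of the decay is exp (- y) to the power \<open>p\<close>: one
    factor for each of the d * k length factors in the volume term.\<close>
  define y where "y = real s / (2 * \<xi> * real p)"
  have y0: "0 \<le> y" using \<xi> by (simp add: y_def)
  have s_eq: "2 * real s = 4 * \<xi> * real p * y" using \<xi> p by (simp add: y_def)
  have e1: "exp (- real s / (2 * \<xi>)) = exp (- y) ^ p"
    using p \<xi> by (simp add: exp_of_nat_mult[symmetric] y_def field_simps)
  have e2: "exp (- real s / \<xi>) = exp (- real s / (2 * \<xi>)) * exp (- real s / (2 * \<xi>))"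
    using \<xi> by (simp add: exp_add[symmetric] field_simps)
  have "(4 * l + 2 * real s + 1) * exp (- y) \<le> 4 * l + 1 + 4 * \<xi> * real p"
  proof -
    have ye: "y * exp (- y) \<le> 1"
    proof -
      have "y \<le> exp y" using exp_ge_add_one_self[of y] by linarith
      then have "y * exp (- y) \<le> exp y * exp (- y)" by (intro mult_right_mono) auto
      then show ?thesis by (simp add: exp_minus)
    qed
    have "(4 * l + 1) * exp (- y) \<le> (4 * l + 1) * 1"
      using y0 r rl by (intro mult_left_mono) auto
    moreover have "4 * \<xi> * real p * (y * exp (- y)) \<le> 4 * \<xi> * real p * 1"
      using ye \<xi> by (intro mult_left_mono) auto
    ultimately show ?thesis unfolding s_eq by (simp add: algebra_simps)
  qed
  also have "\<dots> \<le> length_const d r \<xi> * max l (real k)"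
  proof -
    have "1 \<le> l / r" using r rl by simp
    also have "l / r \<le> (1 / r) * max l (real k)" using r by (simp add: divide_right_mono)
    finally have 1: "1 \<le> (1 / r) * max l (real k)" .
    have 2: "4 * \<xi> * real p \<le> 4 * \<xi> * real d * max l (real k)"
      using \<xi> by (simp add: p_def mult_left_mono)
    have 3: "4 * l \<le> 4 * max l (real k)" by simp
    show ?thesis unfolding length_const_def using 1 2 3 by (simp only: distrib_right)
  qed
  finally have "((4 * l + 2 * real s + 1) * exp (- y)) ^ p \<le> (length_const d r \<xi> * max l (real k)) ^ p"
    using r rl by (intro power_mono) auto
  then have "exp (- real s / (2 * \<xi>)) * (4 * l + 2 * real s + 1) ^ p \<le> (length_const d r \<xi> * max l (real k)) ^ p"
    unfolding e1 by (simp only: power_mult_distrib mult.commute)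
  then have "exp (- real s / (2 * \<xi>)) * (exp (- real s / (2 * \<xi>)) * (4 * l + 2 * real s + 1) ^ p)
      \<le> exp (- real s / (2 * \<xi>)) * (length_const d r \<xi> * max l (real k)) ^ p"
    by (intro mult_left_mono) auto
  then show ?thesis unfolding e2 by (simp add: p_def power_mult mult.assoc)
qed

lemma geometric_sum_le:
  assumes "0 < \<xi>"
  shows "(\<Sum>s\<le>M. exp (- real s / (2 * \<xi>))) \<le> 1 / (1 - exp (- 1 / (2 * \<xi>)))"
proof -
  define q where "q = exp (- 1 / (2 * \<xi>))"
  have q: "0 \<le> q" "q < 1" using exp_minus_less_one[OF assms] by (simp_all add: q_def)
  have "exp (- real s / (2 * \<xi>)) = q ^ s" for s
    by (simp add: q_def exp_of_nat_mult[symmetric])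
  then have "(\<Sum>s\<le>M. exp (- real s / (2 * \<xi>))) = (\<Sum>s<Suc M. q ^ s)"
    by (simp add: lessThan_Suc_atMost)
  also have "\<dots> \<le> (\<Sum>s. q ^ s)"
    using q by (intro sum_le_suminf summable_geometric) auto
  also have "\<dots> = 1 / (1 - q)" using q by (intro suminf_geometric) auto
  finally show ?thesis by (simp add: q_def)
qed

section \<open>Layers of words, by the scale at which no letter is isolated\<close>

context centred_observable
begin

text \<open>Two supports of radius \<open>l\<close> around sites that are not close are more than
  \<open>s\<close> apart. A repeated site counts as close to itself, so words with coinciding
  letters are covered.\<close>

definition close :: "nat \<Rightarrow> nat \<Rightarrow> nat \<Rightarrow> bool" where
  "close s i j \<longleftrightarrow> i < n \<and> j < n \<and> manhattan (pos i) (pos j) \<le> 2 * l + real s"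

definition clustered_words :: "nat \<Rightarrow> nat \<Rightarrow> nat list set" where
  "clustered_words k s = {t. set t \<subseteq> {..<n} \<and> length t = 2 * k \<and>
     (\<forall>j<2 * k. \<exists>i<2 * k. i \<noteq> j \<and> close s (t ! i) (t ! j))}"

lemma card_clustered_words:
  "real (card (clustered_words k s)) \<le> (4 * real n * real k * (4 * l + 2 * real s + 1) ^ d) ^ k"
proof -
  have "real (card {j \<in> {..<n}. close s i j}) \<le> (4 * l + 2 * real s + 1) ^ d" if "i \<in> {..<n}" for i
  proof -
    have "{j \<in> {..<n}. close s i j} = site_ball n pos i (2 * l + real s)"
      using that by (auto simp: close_def site_ball_def)
    then show ?thesis
      using card_site_ball_le[OF inj len, where i=i and R="2 * l + real s"] that r rl
      by (simp add: algebra_simps)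
  qed
  moreover have "close s i j \<Longrightarrow> close s j i" for i j
    using len by (auto simp: close_def manhattan_commute)
  ultimately show ?thesis
    using card_words_without_isolated[of "{..<n}" "close s" "(4 * l + 2 * real s + 1) ^ d" k] r rl
    unfolding clustered_words_def by simp
qed

text \<open>At the diameter of the lattice every pair of sites is close, and k >= 1 ensures that
  each position has another one. This keeps the sum over scales finite; the sum of all distances is
  a convenient bound on the diameter.\<close>

lemma exists_clustering_scale:
  assumes "1 \<le> k"
  shows "\<exists>M. \<forall>t. set t \<subseteq> {..<n} \<longrightarrow> length t = 2 * k \<longrightarrow> t \<in> clustered_words k M"
proof (intro exI allI impI)
  define D where "D = (\<Sum>(i, j)\<in>{..<n} \<times> {..<n}. manhattan (pos i) (pos j))"
  fix t :: "nat list" assume t: "set t \<subseteq> {..<n}" "length t = 2 * k"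
  have close: "close (nat \<lceil>D\<rceil>) i j" if "i < n" "j < n" for i j
  proof -
    have "manhattan (pos i) (pos j) \<le> D"
      unfolding D_def using that
      by (intro member_le_sum[where f="\<lambda>(i, j). manhattan (pos i) (pos j)" and i="(i, j)", simplified])
        (auto simp: manhattan_nonneg)
    then show ?thesis using that r rl of_nat_ceiling[of D] by (simp add: close_def)
  qed
  show "t \<in> clustered_words k (nat \<lceil>D\<rceil>)"
    unfolding clustered_words_def
  proof (intro CollectI conjI allI impI t)
    fix j assume j: "j < 2 * k"
    define i :: nat where "i = (if j = 0 then 1 else 0)"
    have "i < 2 * k" "i \<noteq> j" using assms by (auto simp: i_def)
    moreover have "t ! i < n" "t ! j < n" using t j \<open>i < 2 * k\<close> by (metis lessThan_iff nth_mem subsetD)+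
    ultimately show "\<exists>i<2 * k. i \<noteq> j \<and> close (nat \<lceil>D\<rceil>) (t ! i) (t ! j)"
      using close by blast
  qed
qed

text \<open>The summand at the least scale where the word has no isolated letter already suffices.
  Adding the summands of the other scales only weakens the bound, but yields a form in which the
  sums over words and scales can be exchanged.\<close>

lemma word_layer_bound:
  assumes k: "1 \<le> k" and t: "set t \<subseteq> {..<n}" "length t = 2 * k" "t \<in> clustered_words k M"
  shows "cmod (trace (\<rho> * word (2 ^ n) h t))
    \<le> 4 ^ k * exp ((r + 1) / \<xi>) * (\<Sum>s\<le>M. if t \<in> clustered_words k s then exp (- real s / \<xi>) else 0)"
proof -
  define s where "s = (LEAST s. t \<in> clustered_words k s)"
  have s: "t \<in> clustered_words k s" unfolding s_def using t(3) by (rule LeastI)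
  have "s \<le> M" unfolding s_def using t(3) by (rule Least_le)
  then have "(if t \<in> clustered_words k s then exp (- real s / \<xi>) else 0)
      \<le> (\<Sum>s\<le>M. if t \<in> clustered_words k s then exp (- real s / \<xi>) else 0)"
    by (intro member_le_sum) auto
  then have sum: "exp (- real s / \<xi>) \<le> (\<Sum>s\<le>M. if t \<in> clustered_words k s then exp (- real s / \<xi>) else 0)"
    using s by simp
  have pow: "2 ^ length t = (4 ^ k :: real)" using t(2) by (simp add: power_mult)
  have trivial: "cmod (trace (\<rho> * word (2 ^ n) h t)) \<le> 4 ^ k"
    using word_bound[OF t(1)] by (simp add: pow)
  have "cmod (trace (\<rho> * word (2 ^ n) h t)) \<le> 4 ^ k * (exp ((r + 1) / \<xi>) * exp (- real s / \<xi>))"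
  proof (cases "real s \<le> r + 1")
    case True
    then have "0 \<le> (r + 1) / \<xi> + (- real s / \<xi>)"
      using \<xi> by (simp add: divide_right_mono)
    then have "1 \<le> exp ((r + 1) / \<xi>) * exp (- real s / \<xi>)"
      by (simp only: exp_add[symmetric] one_le_exp_iff)
    then have "4 ^ k * 1 \<le> (4 ^ k :: real) * (exp ((r + 1) / \<xi>) * exp (- real s / \<xi>))"
      by (intro mult_left_mono) auto
    then show ?thesis using trivial by linarith
  next
    case False
    \<comment> \<open>By minimality the word has an isolated letter at the preceding scale, which is
      still at least \<open>r\<close>, so clustering applies there. The lost unit of distance costs
      exp (1 / \<xi>).\<close>
    then obtain s' where s': "s = Suc s'" using r by (cases s) auto
    have "t \<notin> clustered_words k s'"
      using not_less_Least[of s' "\<lambda>s. t \<in> clustered_words k s"] s' by (simp add: s_def)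
    then obtain j where j: "j < 2 * k" "\<And>i. i < 2 * k \<Longrightarrow> i \<noteq> j \<Longrightarrow> \<not> close s' (t ! i) (t ! j)"
      using t unfolding clustered_words_def by blast
    have mem: "t ! i < n" if "i < 2 * k" for i using t that by (metis lessThan_iff nth_mem subsetD)
    have "cmod (trace (\<rho> * word (2 ^ n) h t)) \<le> 2 ^ length t * exp (- real s' / \<xi>)"
    proof (rule word_isolated_bound[where j=j])
      show "2 \<le> length t" "j < length t" using t k j by auto
      show "r \<le> real s'" using False s' by simp
      fix i assume "i < length t" "i \<noteq> j"
      then show "2 * l + real s' < manhattan (pos (t ! i)) (pos (t ! j))"
        using j(2)[of i] mem[of i] mem[OF j(1)] t(2) by (simp add: close_def not_le)
    qed (rule t)
    also have "\<dots> \<le> 4 ^ k * (exp ((r + 1) / \<xi>) * exp (- real s / \<xi>))"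
      unfolding pow exp_add[symmetric]
    proof (intro mult_left_mono)
      have "- real s' / \<xi> = 1 / \<xi> + - real s / \<xi>" by (simp add: s' add_divide_distrib[symmetric])
      also have "\<dots> \<le> (r + 1) / \<xi> + - real s / \<xi>" using r \<xi> by (simp add: divide_right_mono)
      finally show "exp (- real s' / \<xi>) \<le> exp ((r + 1) / \<xi> + - real s / \<xi>)" by simp
    qed simp
    finally show ?thesis .
  qed
  also have "\<dots> \<le> 4 ^ k * (exp ((r + 1) / \<xi>) * (\<Sum>s\<le>M. if t \<in> clustered_words k s then exp (- real s / \<xi>) else 0))"
    using sum by (intro mult_left_mono) auto
  finally show ?thesis by (simp only: mult.assoc)
qed

lemma moment_bound:
  assumes k: "1 \<le> k"
  shows "cmod (trace (\<rho> * site_sum n h ^\<^sub>m (2 * k)))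
    \<le> moment_const r \<xi> * (16 * real n * real k * (length_const d r \<xi> * max l (real k)) ^ d) ^ k"
proof -
  let ?L = "{t. set t \<subseteq> {..<n} \<and> length t = 2 * k}"
  let ?K = "exp ((r + 1) / \<xi>)" and ?c = "(length_const d r \<xi> * max l (real k)) ^ d"
  have finL: "finite ?L" by (rule finite_lists_length_eq) simp
  obtain M where M: "\<And>t. set t \<subseteq> {..<n} \<Longrightarrow> length t = 2 * k \<Longrightarrow> t \<in> clustered_words k M"
    using exists_clustering_scale[OF k] by auto
  have sub: "clustered_words k s \<subseteq> ?L" for s by (auto simp: clustered_words_def)
  have "cmod (trace (\<rho> * site_sum n h ^\<^sub>m (2 * k))) \<le> (\<Sum>t\<in>?L. cmod (trace (\<rho> * word (2 ^ n) h t)))"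
    by (subst trace_mult_site_sum_pow) (auto intro: h_carrier \<rho> norm_sum)
  also have "\<dots> \<le> (\<Sum>t\<in>?L. 4 ^ k * ?K * (\<Sum>s\<le>M. if t \<in> clustered_words k s then exp (- real s / \<xi>) else 0))"
    using word_layer_bound[OF k] M by (intro sum_mono) auto
  also have "\<dots> = 4 ^ k * ?K * (\<Sum>s\<le>M. \<Sum>t\<in>?L. if t \<in> clustered_words k s then exp (- real s / \<xi>) else 0)"
    by (simp only: sum_distrib_left[symmetric], subst sum.swap, rule refl)
  also have "\<dots> = 4 ^ k * ?K * (\<Sum>s\<le>M. real (card (clustered_words k s)) * exp (- real s / \<xi>))"
    using sub by (simp add: sum.If_cases[OF finL] Int_absorb1)
  also have "\<dots> \<le> 4 ^ k * ?K * (\<Sum>s\<le>M. (4 * real n * real k) ^ k * (exp (- real s / (2 * \<xi>)) * ?c ^ k))"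
  proof (intro mult_left_mono sum_mono)
    fix s
    have "real (card (clustered_words k s)) * exp (- real s / \<xi>)
        \<le> (4 * real n * real k * (4 * l + 2 * real s + 1) ^ d) ^ k * exp (- real s / \<xi>)"
      by (intro mult_right_mono card_clustered_words) simp
    also have "\<dots> = (4 * real n * real k) ^ k * (exp (- real s / \<xi>) * ((4 * l + 2 * real s + 1) ^ d) ^ k)"
      by (simp add: power_mult_distrib)
    also have "\<dots> \<le> (4 * real n * real k) ^ k * (exp (- real s / (2 * \<xi>)) * ?c ^ k)"
      by (intro mult_left_mono decay_times_volume_le d k r \<xi> rl) simp
    finally show "real (card (clustered_words k s)) * exp (- real s / \<xi>)
        \<le> (4 * real n * real k) ^ k * (exp (- real s / (2 * \<xi>)) * ?c ^ k)" .
  qed simp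
  also have "\<dots> = (4 ^ k * (4 * real n * real k) ^ k * ?c ^ k) * (?K * (\<Sum>s\<le>M. exp (- real s / (2 * \<xi>))))"
    by (simp add: sum_distrib_left sum_distrib_right mult_ac)
  also have "\<dots> \<le> (4 ^ k * (4 * real n * real k) ^ k * ?c ^ k) * (?K * (1 / (1 - exp (- 1 / (2 * \<xi>)))))"
    using r \<xi> rl by (intro mult_left_mono geometric_sum_le)
      (auto simp: length_const_def)
  also have "\<dots> = moment_const r \<xi> * (16 * real n * real k * ?c) ^ k"
  proof -
    \<comment> \<open>One factor 4 is the norm bound 2 on each of 2 * k letters, the other comes
      from counting words.\<close>
    have "(16 :: real) ^ k = 4 ^ k * 4 ^ k" by (simp add: power_mult_distrib[symmetric])
    then show ?thesis by (simp add: moment_const_def power_mult_distrib)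
  qed
  finally show ?thesis .
qed

end

subsection \<open>Canonical states\<close>

lemma partition_function_square:
  assumes "S \<in> carrier_mat N N" "self_adjoint S" "mat_exp (complex_of_real (- \<beta>) \<cdot>\<^sub>m H) = S * S"
  shows "partition_function \<beta> H = frob N S"
  using assms trace_square[of S N] by (simp add: partition_function_def)

text \<open>An eigenvector of energy E contributes the squared norm of its image under
  \<open>S\<close>, which is exp (- \<beta> E); Bessel's inequality collects the contributions. The
  family need not be complete.\<close>

lemma partition_function_ge:
  assumes H: "H \<in> carrier_mat N N" "self_adjoint H"
    and B: "finite B" "B \<subseteq> carrier_vec N" "orthonormal B"
    and ev: "\<And>\<phi>. \<phi> \<in> B \<Longrightarrow> H *\<^sub>v \<phi> = complex_of_real (E \<phi>) \<cdot>\<^sub>v \<phi>"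
  shows "(\<Sum>\<phi>\<in>B. exp (- \<beta> * E \<phi>)) \<le> partition_function \<beta> H"
proof -
  obtain S where S: "S \<in> carrier_mat N N" "self_adjoint S"
    "mat_exp (complex_of_real (- \<beta>) \<cdot>\<^sub>m H) = S * S"
    "\<And>v E. v \<in> carrier_vec N \<Longrightarrow> H *\<^sub>v v = complex_of_real E \<cdot>\<^sub>v v \<Longrightarrow>
       S *\<^sub>v v = complex_of_real (exp (- \<beta> * E / 2)) \<cdot>\<^sub>v v"
    using gibbs_square_root[OF H, of \<beta>] by metis
  have "(\<Sum>\<phi>\<in>B. exp (- \<beta> * E \<phi>)) = (\<Sum>\<phi>\<in>B. (vnorm (S *\<^sub>v \<phi>))\<^sup>2)"
  proof (intro sum.cong refl)
    fix \<phi> assume \<phi>: "\<phi> \<in> B"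
    then have c: "\<phi> \<in> carrier_vec N" using B by auto
    have "\<phi> \<bullet>c \<phi> = 1" using \<phi> B(3) by (auto simp: orthonormal_def)
    then have "vnorm \<phi> = 1" by (simp add: vnorm_def)
    then have "vnorm (S *\<^sub>v \<phi>) = exp (- \<beta> * E \<phi> / 2)"
      unfolding S(4)[OF c ev[OF \<phi>]] vnorm_smult[OF c] by simp
    then show "exp (- \<beta> * E \<phi>) = (vnorm (S *\<^sub>v \<phi>))\<^sup>2"
      by (simp add: power2_eq_square exp_add[symmetric])
  qed
  also have "\<dots> \<le> partition_function \<beta> H"
    unfolding partition_function_square[OF S(1-3)] by (rule sum_vnorm_le_frob[OF B S(1)])
  finally show ?thesis .
qed

lemma canonical_state_carrier:
  "H \<in> carrier_mat N N \<Longrightarrow> canonical_state \<beta> H \<in> carrier_mat N N"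
  by (simp add: canonical_state_def)

lemma self_adjoint_canonical_state:
  assumes H: "H \<in> carrier_mat N N" "self_adjoint H"
  shows "self_adjoint (canonical_state \<beta> H)"
  unfolding canonical_state_def
  using H by (intro self_adjoint_smult[where N=N] self_adjoint_mat_exp[where N=N]) auto

lemma trace_smult_mult:
  assumes "A \<in> carrier_mat N N" "B \<in> carrier_mat N N"
  shows "trace ((c \<cdot>\<^sub>m A) * B) = c * trace (A * B)"
proof -
  have cA: "c \<cdot>\<^sub>m A \<in> carrier_mat N N" using assms by simp
  show ?thesis
    unfolding trace_mult[OF cA assms(2)] trace_mult[OF assms] sum_distrib_left
    using assms by (intro sum.cong refl) auto
qed

lemma cmod_trace_canonical_state_le:
  assumes H: "H \<in> carrier_mat N N" "self_adjoint H" and Z: "0 < partition_function \<beta> H"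
    and A: "op_bounded N A c"
  shows "cmod (trace (canonical_state \<beta> H * A)) \<le> c"
proof -
  obtain S where S: "S \<in> carrier_mat N N" "self_adjoint S"
    "mat_exp (complex_of_real (- \<beta>) \<cdot>\<^sub>m H) = S * S"
    using gibbs_square_root[OF H, of \<beta>] by metis
  have "trace (canonical_state \<beta> H * A) = complex_of_real (1 / partition_function \<beta> H) * trace (S * S * A)"
    unfolding canonical_state_def S(3) using S(1) op_bounded_carrier[OF A]
    by (intro trace_smult_mult[where N=N]) auto
  then have "cmod (trace (canonical_state \<beta> H * A)) = cmod (trace (S * S * A)) / partition_function \<beta> H"
    using Z by (simp add: norm_mult norm_divide)
  also have "\<dots> \<le> c * partition_function \<beta> H / partition_function \<beta> H"
    using Z cmod_trace_square_mult_le[OF S(1,2) A]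
    by (intro divide_right_mono) (auto simp: partition_function_square[OF S])
  finally show ?thesis using Z by simp
qed

lemma trace_canonical_state:
  assumes H: "H \<in> carrier_mat N N" "self_adjoint H" and Z: "0 < partition_function \<beta> H"
  shows "trace (canonical_state \<beta> H) = 1"
proof -
  obtain S where S: "S \<in> carrier_mat N N" "self_adjoint S"
    "mat_exp (complex_of_real (- \<beta>) \<cdot>\<^sub>m H) = S * S"
    using gibbs_square_root[OF H, of \<beta>] by metis
  have "trace (canonical_state \<beta> H * 1\<^sub>m N) = complex_of_real (1 / partition_function \<beta> H) * trace (S * S * 1\<^sub>m N)"
    unfolding canonical_state_def S(3) using S(1)
    by (intro trace_smult_mult[where N=N]) auto
  also have "trace (S * S * 1\<^sub>m N) = complex_of_real (partition_function \<beta> H)"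
    using S trace_square[OF S(1,2)] partition_function_square[OF S] by simp
  finally show ?thesis using Z canonical_state_carrier[OF H(1), of \<beta>] by simp
qed

lemma eigenstate_le_canonical:
  assumes H: "H \<in> carrier_mat N N" "self_adjoint H" and Z: "0 < partition_function \<beta> H"
    and \<phi>: "\<phi> \<in> carrier_vec N" "vnorm \<phi> = 1" "H *\<^sub>v \<phi> = complex_of_real E \<cdot>\<^sub>v \<phi>"
    and K: "K \<in> carrier_mat N N" "self_adjoint K"
  shows "(vnorm (K *\<^sub>v \<phi>))\<^sup>2
    \<le> partition_function \<beta> H * exp (\<beta> * E) * cmod (trace (canonical_state \<beta> H * (K * K)))"
proof -
  obtain S where S: "S \<in> carrier_mat N N" "self_adjoint S"
    "mat_exp (complex_of_real (- \<beta>) \<cdot>\<^sub>m H) = S * S"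
    "\<And>v E. v \<in> carrier_vec N \<Longrightarrow> H *\<^sub>v v = complex_of_real E \<cdot>\<^sub>v v \<Longrightarrow>
       S *\<^sub>v v = complex_of_real (exp (- \<beta> * E / 2)) \<cdot>\<^sub>v v"
    using gibbs_square_root[OF H, of \<beta>] by metis
  have "trace (canonical_state \<beta> H * (K * K))
      = complex_of_real (1 / partition_function \<beta> H) * trace (S * S * (K * K))"
    unfolding canonical_state_def S(3) using S(1) K
    by (intro trace_smult_mult[where N=N]) auto
  then have tr: "cmod (trace (S * S * (K * K))) = partition_function \<beta> H * cmod (trace (canonical_state \<beta> H * (K * K)))"
    using Z by (simp add: norm_mult norm_divide)
  have "exp (- \<beta> * E) * (vnorm (K *\<^sub>v \<phi>))\<^sup>2 = (exp (- \<beta> * E / 2))\<^sup>2 * (vnorm (K *\<^sub>v \<phi>))\<^sup>2"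
    by (simp add: power2_eq_square exp_add[symmetric])
  also have "\<dots> \<le> Re (trace (S * S * (K * K)))"
    using trace_square_square_ge[OF S(1,2) K \<phi>(1,2) S(4)[OF \<phi>(1,3)]] .
  also have "\<dots> \<le> partition_function \<beta> H * cmod (trace (canonical_state \<beta> H * (K * K)))"
    unfolding tr[symmetric] by (rule complex_Re_le_cmod)
  finally have "exp (\<beta> * E) * (exp (- \<beta> * E) * (vnorm (K *\<^sub>v \<phi>))\<^sup>2)
      \<le> exp (\<beta> * E) * (partition_function \<beta> H * cmod (trace (canonical_state \<beta> H * (K * K))))"
    by (intro mult_left_mono) auto
  moreover have "exp (\<beta> * E) * (exp (- \<beta> * E) * (vnorm (K *\<^sub>v \<phi>))\<^sup>2) = (vnorm (K *\<^sub>v \<phi>))\<^sup>2"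
    by (simp add: mult.assoc[symmetric] exp_add[symmetric])
  moreover have "exp (\<beta> * E) * (partition_function \<beta> H * cmod (trace (canonical_state \<beta> H * (K * K))))
      = partition_function \<beta> H * exp (\<beta> * E) * cmod (trace (canonical_state \<beta> H * (K * K)))"
    by simp
  ultimately show ?thesis by linarith
qed

lemma (in centred_observable) eigenstate_expect_bound:
  assumes H: "H \<in> carrier_mat (2 ^ n) (2 ^ n)" "self_adjoint H" and Z: "0 < partition_function \<beta> H"
    and \<rho>_eq: "\<rho> = canonical_state \<beta> H" and sa: "self_adjoint (site_sum n h)"
    and \<phi>: "\<phi> \<in> carrier_vec (2 ^ n)" "vnorm \<phi> = 1" "H *\<^sub>v \<phi> = complex_of_real E \<cdot>\<^sub>v \<phi>"
    and k: "1 \<le> k" "\<beta> * E + ln (partition_function \<beta> H) \<le> real k"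
  shows "cmod (expect (site_sum n h) \<phi>)
    \<le> sqrt (exp 1 * moment_const r \<xi> * 16 * real n * real k * (length_const d r \<xi> * max l (real k)) ^ d)"
proof -
  let ?W = "site_sum n h" and ?M = "moment_const r \<xi>"
  let ?c = "16 * real n * real k * (length_const d r \<xi> * max l (real k)) ^ d"
  have c0: "0 \<le> ?c" using r \<xi> rl by (simp add: length_const_def)
  have M1: "1 \<le> ?M" using r \<xi> by (rule moment_const_ge_one)
  have "((cmod (expect ?W \<phi>))\<^sup>2) ^ k = (cmod (expect ?W \<phi>) ^ k)\<^sup>2"
    by (simp add: power_mult[symmetric] mult.commute)
  also have "\<dots> \<le> (vnorm (?W ^\<^sub>m k *\<^sub>v \<phi>))\<^sup>2"
    using expect_power_le[OF site_sum_carrier sa \<phi>(1,2)] by (intro power_mono) auto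
  also have "\<dots> \<le> partition_function \<beta> H * exp (\<beta> * E) * cmod (trace (\<rho> * (?W ^\<^sub>m k * ?W ^\<^sub>m k)))"
    unfolding \<rho>_eq
    by (rule eigenstate_le_canonical[OF H Z \<phi>]) (simp_all add: self_adjoint_pow[OF site_sum_carrier sa])
  also have "?W ^\<^sub>m k * ?W ^\<^sub>m k = ?W ^\<^sub>m (2 * k)"
    using pow_mat_add[of ?W "2 ^ n" k k] by (simp add: mult_2)
  also have "partition_function \<beta> H * exp (\<beta> * E) = exp (\<beta> * E + ln (partition_function \<beta> H))"
    using Z by (simp add: exp_add)
  also have "exp (\<beta> * E + ln (partition_function \<beta> H)) * cmod (trace (\<rho> * ?W ^\<^sub>m (2 * k)))
      \<le> exp (real k) * (?M * ?c ^ k)"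
    using k moment_bound[OF k(1)] by (intro mult_mono) auto
  \<comment> \<open>Everything becomes a k-th power before the root is taken; the moment constant
    may be raised to the power \<open>k\<close> because it is at least 1.\<close>
  also have "\<dots> \<le> exp 1 ^ k * (?M ^ k * ?c ^ k)"
  proof (intro mult_mono)
    show "exp (real k) \<le> exp 1 ^ k" by (simp add: exp_of_nat_mult[symmetric])
    show "?M \<le> ?M ^ k" using M1 k(1) by (intro self_le_power) auto
  qed (use c0 M1 in auto)
  also have "\<dots> = (exp 1 * ?M * ?c) ^ k" by (simp only: power_mult_distrib mult.assoc)
  finally have pow_le: "((cmod (expect ?W \<phi>))\<^sup>2) ^ k \<le> (exp 1 * ?M * ?c) ^ k" .
  have "0 \<le> exp 1 * ?M" using M1 by simp
  then have nonneg: "0 \<le> exp 1 * ?M * ?c" using c0 by (rule mult_nonneg_nonneg)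
  have "(cmod (expect ?W \<phi>))\<^sup>2 \<le> exp 1 * ?M * ?c"
  proof (rule ccontr)
    assume "\<not> (cmod (expect ?W \<phi>))\<^sup>2 \<le> exp 1 * ?M * ?c"
    then have "exp 1 * ?M * ?c < (cmod (expect ?W \<phi>))\<^sup>2" by (simp only: not_le)
    then have "(exp 1 * ?M * ?c) ^ k < ((cmod (expect ?W \<phi>))\<^sup>2) ^ k"
      using k(1) by (intro power_strict_mono[OF _ nonneg]) auto
    then show False using pow_le by (rule leD[THEN notE, rotated])
  qed
  then show ?thesis by (intro real_le_rsqrt) (simp add: mult.assoc)
qed

subsection \<open>Expectation values\<close>

lemma expect_smult:
  assumes "A \<in> carrier_mat N N" "\<phi> \<in> carrier_vec N"
  shows "expect (c \<cdot>\<^sub>m A) \<phi> = c * expect A \<phi>"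
  using assms by (simp add: expect_def smult_mat_mult_vec[OF assms])

lemma expect_add_scalar:
  assumes A: "A \<in> carrier_mat N N" and \<phi>: "\<phi> \<in> carrier_vec N" "vnorm \<phi> = 1"
  shows "expect (A + c \<cdot>\<^sub>m 1\<^sub>m N) \<phi> = expect A \<phi> + c"
proof -
  have "(A + c \<cdot>\<^sub>m 1\<^sub>m N) *\<^sub>v \<phi> = A *\<^sub>v \<phi> + c \<cdot>\<^sub>v \<phi>"
    using A \<phi> by (simp add: add_mult_distrib_mat_vec[where nr=N and nc=N] smult_mat_mult_vec[where N=N])
  moreover have "\<phi> \<bullet>c \<phi> = 1" using vnorm_square(2)[OF \<phi>(1)] \<phi>(2) by simp
  moreover have "A *\<^sub>v \<phi> \<in> carrier_vec N" using A \<phi> by (auto intro: mult_mat_vec_carrier)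
  ultimately show ?thesis
    using \<phi> by (simp add: expect_def add_scalar_prod_distrib[where n=N])
qed

text \<open>Needed for a nondegenerate ground space, where the given eigenvector agrees with the
  basis vector only up to a phase.\<close>

lemma expect_phase:
  assumes A: "A \<in> carrier_mat N N" and \<phi>: "\<phi> \<in> carrier_vec N" and c: "cmod c = 1"
  shows "expect A (c \<cdot>\<^sub>v \<phi>) = expect A \<phi>"
proof -
  have Ac: "A *\<^sub>v (c \<cdot>\<^sub>v \<phi>) = c \<cdot>\<^sub>v (A *\<^sub>v \<phi>)" using A \<phi> by (simp add: mult_mat_vec)
  have car: "A *\<^sub>v \<phi> \<in> carrier_vec N" using A \<phi> by (auto intro: mult_mat_vec_carrier)
  have "c * cnj c = 1" using c complex_norm_square[of c] by simp
  then have cc: "c * x * (cnj c * y) = x * y" for x y :: complex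
    by (metis mult.assoc mult.commute mult_1)
  have "expect A (c \<cdot>\<^sub>v \<phi>) = (\<Sum>i<N. c * (A *\<^sub>v \<phi>) $ i * (cnj c * cnj (\<phi> $ i)))"
    using A car \<phi> unfolding expect_def Ac by (subst cinner_sum[where N=N]) auto
  also have "\<dots> = expect A \<phi>"
    unfolding cc expect_def by (simp only: cinner_sum[OF \<phi>])
  finally show ?thesis .
qed

lemma self_adjoint_site_sum:
  assumes "\<And>i. i < n \<Longrightarrow> h i \<in> carrier_mat (2 ^ n) (2 ^ n)" "\<And>i. i < n \<Longrightarrow> self_adjoint (h i)"
  shows "self_adjoint (site_sum n h)"
  using self_adjoint_entry[OF assms(2) assms(1), symmetric]
  by (subst self_adjoint_iff[where N="2 ^ n"]) (auto simp: site_sum_def intro!: sum.cong)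

lemma site_sum_add_scalar:
  assumes "\<And>i. i < n \<Longrightarrow> w i \<in> carrier_mat (2 ^ n) (2 ^ n)"
  shows "site_sum n (\<lambda>i. w i + c i \<cdot>\<^sub>m 1\<^sub>m (2 ^ n)) = site_sum n w + (\<Sum>i<n. c i) \<cdot>\<^sub>m 1\<^sub>m (2 ^ n)"
  using assms by (intro eq_matI) (auto simp: site_sum_def sum.distrib)

lemma self_adjoint_add_scalar:
  assumes A: "A \<in> carrier_mat N N" "self_adjoint A" and c: "Im c = 0"
  shows "self_adjoint (A + c \<cdot>\<^sub>m 1\<^sub>m N)"
proof -
  have "cnj c = c" using c by (simp add: complex_eq_iff)
  then show ?thesis
    using A(1) self_adjoint_entry[OF A(2,1), symmetric]
    by (subst self_adjoint_iff[where N=N]) auto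
qed

lemma trace_mult_add_scalar:
  assumes "A \<in> carrier_mat N N" "B \<in> carrier_mat N N"
  shows "trace (A * (B + c \<cdot>\<^sub>m 1\<^sub>m N)) = trace (A * B) + c * trace A"
proof -
  have "trace (A * (B + c \<cdot>\<^sub>m 1\<^sub>m N)) = (\<Sum>i<N. \<Sum>j<N. A $$ (i, j) * B $$ (j, i) + (if j = i then c * A $$ (i, i) else 0))"
  proof -
    have car: "B + c \<cdot>\<^sub>m 1\<^sub>m N \<in> carrier_mat N N" using assms by simp
    show ?thesis
      unfolding trace_mult[OF assms(1) car] using assms
      by (intro sum.cong refl) (auto simp: algebra_simps)
  qed
  also have "\<dots> = trace (A * B) + c * trace A"
    using assms by (simp add: sum.distrib trace_mult[OF assms] sum_distrib_left trace_def[of A])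
  finally show ?thesis .
qed

subsection \<open>The ground space\<close>

text \<open>An empty basis would span only 0, and a singleton spans a line. The first conclusion
  makes the ground-state average meaningful, the second handles a unique ground state.\<close>

lemma orthonormal_basis_span:
  assumes "orthonormal_basis N V B" "V \<noteq> {0\<^sub>v N}" "V \<subseteq> carrier_vec N"
  shows "B \<noteq> {}" and "B = {g} \<Longrightarrow> \<psi> \<in> V \<Longrightarrow> \<exists>c. \<psi> = c \<cdot>\<^sub>v g"
proof -
  interpret vec_space "TYPE(complex)" N .
  have span: "span B = V" using assms(1) by (simp add: orthonormal_basis_def)
  show "B \<noteq> {}" using span assms(2) span_empty by auto
  assume B: "B = {g}" and \<psi>: "\<psi> \<in> V"
  have g: "g \<in> carrier_vec N" using assms(1,3) B by (auto simp: orthonormal_basis_def)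
  have "\<psi> \<in> span {g}" using span B \<psi> by simp
  then obtain a where "\<psi> = lincomb a {g}"
    using finite_span[of "{g}"] g by auto
  also have "lincomb a {g} = a g \<cdot>\<^sub>v g"
    using g by (simp add: lincomb_def)
  finally show "\<exists>c. \<psi> = c \<cdot>\<^sub>v g" by blast
qed

lemma eigenvectors_orthogonal:
  assumes H: "H \<in> carrier_mat N N" "self_adjoint H"
    and u: "u \<in> carrier_vec N" "H *\<^sub>v u = complex_of_real e \<cdot>\<^sub>v u"
    and v: "v \<in> carrier_vec N" "H *\<^sub>v v = complex_of_real e' \<cdot>\<^sub>v v" and "e \<noteq> e'"
  shows "u \<bullet>c v = 0"
proof -
  have "complex_of_real e * (u \<bullet>c v) = (H *\<^sub>v u) \<bullet>c v" using u v by simp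
  also have "\<dots> = u \<bullet>c (H *\<^sub>v v)" by (rule self_adjoint_cinner[OF H(2,1) u(1) v(1)])
  also have "\<dots> = complex_of_real e' * (u \<bullet>c v)"
    using u v by (simp add: cinner_sum[where N=N] sum_distrib_left mult_ac)
  finally show ?thesis using \<open>e \<noteq> e'\<close> by simp
qed

lemma half_le_ln_2: "1 / 2 \<le> ln (2::real)"
  using ln_le_minus_one[of "1 / 2"] by (simp add: ln_div)

text \<open>Two orthonormal eigenvectors suffice. Two ground states give Z >= 2; an excited state
  together with a ground state gives exp (\<beta> E) * Z >= exp (\<beta> E) + 1 >= 2.\<close>

lemma excess_ge_ln_2:
  assumes H: "H \<in> carrier_mat N N" "self_adjoint H"
    and \<psi>: "\<psi> \<in> carrier_vec N" "vnorm \<psi> = 1" "H *\<^sub>v \<psi> = complex_of_real E \<cdot>\<^sub>v \<psi>"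
    and E: "0 \<le> E" and \<beta>: "0 < \<beta>"
    and G: "orthonormal_basis N (eigenspace H 0) G" "G \<noteq> {}"
    and excited: "E \<noteq> 0 \<or> 2 \<le> card G"
  shows "ln 2 \<le> \<beta> * E + ln (partition_function \<beta> H)"
proof -
  let ?Z = "partition_function \<beta> H"
  have Gc: "finite G" "G \<subseteq> carrier_vec N" "orthonormal G"
    and ground: "\<And>g. g \<in> G \<Longrightarrow> H *\<^sub>v g = complex_of_real 0 \<cdot>\<^sub>v g"
    using G H(1) by (auto simp: orthonormal_basis_def orthonormal_def eigenspace_def)
  show ?thesis
  proof (cases "E = 0")
    case True
    then have "2 \<le> real (card G)" using excited by simp
    also have "real (card G) = (\<Sum>\<phi>\<in>G. exp (- \<beta> * 0))" by simp
    also have "\<dots> \<le> ?Z" by (rule partition_function_ge[OF H Gc ground])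
    finally show ?thesis using True by simp
  next
    case False
    obtain g where g: "g \<in> G" using G(2) by blast
    then have gc: "g \<in> carrier_vec N" using Gc by auto
    have orth: "\<psi> \<bullet>c g = 0" "g \<bullet>c \<psi> = 0"
      using eigenvectors_orthogonal[OF H \<psi>(1,3) gc ground[OF g] False]
        eigenvectors_orthogonal[OF H gc ground[OF g] \<psi>(1,3)] False by auto
    have unit: "g \<bullet>c g = 1" "\<psi> \<bullet>c \<psi> = 1"
      using Gc(3) g vnorm_square(2)[OF \<psi>(1)] \<psi>(2) by (auto simp: orthonormal_def)
    have ne: "\<psi> \<noteq> g" using orth unit by auto
    have "orthonormal {\<psi>, g}" using orth unit ne by (auto simp: orthonormal_def)
    then have "(\<Sum>\<phi>\<in>{\<psi>, g}. exp (- \<beta> * (if \<phi> = \<psi> then E else 0))) \<le> ?Z"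
      using \<psi> gc ground[OF g] by (intro partition_function_ge[OF H]) auto
    then have "exp (- \<beta> * E) + 1 \<le> ?Z" using ne by simp
    then have "exp (\<beta> * E) * (exp (- \<beta> * E) + 1) \<le> exp (\<beta> * E) * ?Z"
      by (intro mult_left_mono) auto
    moreover have "exp (\<beta> * E) * (exp (- \<beta> * E) + 1) = 1 + exp (\<beta> * E)"
      by (simp add: distrib_left exp_add[symmetric])
    moreover have "1 \<le> exp (\<beta> * E)" using E \<beta> by simp
    ultimately have "2 \<le> exp (\<beta> * E) * ?Z" by linarith
    then have "ln 2 \<le> ln (exp (\<beta> * E) * ?Z)" by simp
    moreover have "0 < ?Z" using \<open>exp (- \<beta> * E) + 1 \<le> ?Z\<close> exp_gt_zero[of "- \<beta> * E"] by linarith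
    ultimately show ?thesis by (simp add: ln_mult)
  qed
qed

section \<open>From the rounded excess to the two regimes of the bound\<close>

text \<open>The larger of \<open>l\<close> and \<open>k\<close> decides which entry of the maximum
  is attained: l^d * k under the root, or the power k^(d + 1).\<close>

lemma sqrt_scale_le:
  fixes x l :: real and k d :: nat
  assumes k: "real k \<le> 3 * x" and x: "0 < x" and l: "0 < l" and k1: "1 \<le> k"
  shows "sqrt (real k * (max l (real k)) ^ d)
    \<le> max (3 powr ((real d + 1) / 2) * x powr ((real d + 1) / 2)) (sqrt 3 * (l ^ d * x) powr (1 / 2))"
proof (cases "real k \<le> l")
  case True
  have "real k * l ^ d \<le> 3 * x * l ^ d" using k l by (intro mult_right_mono) auto
  then have "sqrt (real k * l ^ d) \<le> sqrt (3 * (l ^ d * x))"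
    by (intro real_sqrt_le_mono) (simp add: mult_ac)
  also have "\<dots> = sqrt 3 * (l ^ d * x) powr (1 / 2)"
    using x l by (simp add: real_sqrt_mult powr_half_sqrt)
  finally show ?thesis using True by (simp add: max_absorb1 le_max_iff_disj)
next
  case False
  have "real k * max l (real k) ^ d = real k powr (real d + 1)"
    using False k1 by (simp add: max_absorb2 powr_add powr_realpow)
  then have "sqrt (real k * max l (real k) ^ d) = real k powr ((real d + 1) / 2)"
    by (simp add: powr_half_sqrt[symmetric] powr_powr)
  also have "\<dots> \<le> (3 * x) powr ((real d + 1) / 2)"
    using k by (intro powr_mono2) auto
  also have "\<dots> = 3 powr ((real d + 1) / 2) * x powr ((real d + 1) / 2)"
    using x by (simp add: powr_mult)
  finally show ?thesis by (simp add: le_max_iff_disj)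
qed

lemma eigenstate_deviation:
  fixes d n :: nat and r \<xi> l :: real
  defines "C \<equiv> exp 1 * moment_const r \<xi> * 16 * length_const d r \<xi> ^ d"
  assumes d: "1 \<le> d" and r: "0 < r" and \<xi>: "0 < \<xi>" and n: "0 < n"
    and L: "length L = d" "bij_betw pos {..<n} (lattice_box L)"
    and H: "H \<in> carrier_mat (2 ^ n) (2 ^ n)" "self_adjoint H" "zero_ground_energy H"
    and rl: "r \<le> l" and w: "local_terms n pos l w"
    and \<beta>: "0 < \<beta>" and clust: "clustering n pos r \<xi> (canonical_state \<beta> H)"
    and ev: "eigenvector H \<psi> (complex_of_real E)" and \<psi>1: "vnorm \<psi> = 1"
    and G: "orthonormal_basis (2 ^ n) (eigenspace H 0) G"
  defines "x \<equiv> \<beta> * E + ln (partition_function \<beta> H)"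
    and "\<Omega> \<equiv> complex_of_real (1 / real n) \<cdot>\<^sub>m site_sum n w"
  shows "cmod (expect \<Omega> \<psi> - average \<Omega> G) \<le> 1 / sqrt (real n) *
    max (2 * sqrt C * 3 powr ((real d + 1) / 2) * x powr ((real d + 1) / 2))
        (2 * sqrt C * sqrt 3 * (l ^ d * x) powr (1 / 2))"
proof -
  let ?N = "2 ^ n :: nat" and ?Z = "partition_function \<beta> H" and ?\<rho> = "canonical_state \<beta> H"
  have C0: "0 \<le> C"
    using moment_const_ge_one[OF r \<xi>] r \<xi> by (simp add: C_def length_const_def)
  have \<psi>: "\<psi> \<in> carrier_vec ?N" "H *\<^sub>v \<psi> = complex_of_real E \<cdot>\<^sub>v \<psi>"
    using ev H(1) by (auto simp: eigenvector_def)
  have E: "0 \<le> E" using H(3) ev by (auto simp: zero_ground_energy_def eigenvalue_def)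
  have sub: "eigenspace H 0 \<subseteq> carrier_vec ?N" using H(1) by (auto simp: eigenspace_def)
  have "eigenspace H 0 \<noteq> {0\<^sub>v ?N}"
  proof -
    obtain v where "eigenvector H v 0" using H(3) by (auto simp: zero_ground_energy_def eigenvalue_def)
    then have "v \<in> eigenspace H 0" "v \<noteq> 0\<^sub>v ?N"
      using H(1) by (auto simp: eigenspace_def eigenvector_def)
    then show ?thesis by auto
  qed
  then have Gne: "G \<noteq> {}" and Gspan: "\<And>g. G = {g} \<Longrightarrow> \<psi> \<in> eigenspace H 0 \<Longrightarrow> \<exists>c. \<psi> = c \<cdot>\<^sub>v g"
    using orthonormal_basis_span[OF G _ sub] by auto
  have Gc: "finite G" "G \<subseteq> carrier_vec ?N" "orthonormal G"
    and ground: "\<And>g. g \<in> G \<Longrightarrow> H *\<^sub>v g = complex_of_real 0 \<cdot>\<^sub>v g"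
    using G H(1) by (auto simp: orthonormal_basis_def orthonormal_def eigenspace_def)
  have G1: "vnorm g = 1" if "g \<in> G" for g
    using Gc(3) that by (simp add: orthonormal_def vnorm_def)
  have card_pos: "0 < card G" using Gc(1) Gne by (simp add: card_gt_0_iff)
  have w_acts: "acts_on n (site_ball n pos i l) (w i)" and w_sa: "self_adjoint (w i)"
    and w_norm: "op_norm (w i) \<le> 1" if "i < n" for i
    using w that by (auto simp: local_terms_def)
  have w_carrier: "w i \<in> carrier_mat ?N ?N" if "i < n" for i
    using w_acts[OF that] by (rule acts_on_carrier)
  have \<Omega>_carrier: "\<Omega> \<in> carrier_mat ?N ?N" by (simp add: \<Omega>_def)
  show ?thesis
  proof (cases "E = 0 \<and> card G = 1")
    case True
    then obtain g where g: "G = {g}" by (auto simp: card_1_singleton_iff)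
    have "\<psi> \<in> eigenspace H 0" using \<psi> True H(1) by (auto simp: eigenspace_def)
    then obtain c where c: "\<psi> = c \<cdot>\<^sub>v g" using Gspan[OF g] by blast
    have gc: "g \<in> carrier_vec ?N" "vnorm g = 1" using Gc G1 g by auto
    have "cmod c = 1" using \<psi>1 gc unfolding c by (simp add: vnorm_smult[OF gc(1)])
    then have "expect \<Omega> \<psi> = expect \<Omega> g" unfolding c by (rule expect_phase[OF \<Omega>_carrier gc(1)])
    then have "expect \<Omega> \<psi> - average \<Omega> G = 0" by (simp add: average_def g)
    then have "cmod (expect \<Omega> \<psi> - average \<Omega> G) = 0" by simp
    \<comment> \<open>No lower bound on \<open>x\<close> is available here; the right-hand side is
      nonnegative because \<open>powr\<close> is so for every base.\<close>
    also have "0 \<le> 1 / sqrt (real n) *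
      max (2 * sqrt C * 3 powr ((real d + 1) / 2) * x powr ((real d + 1) / 2))
          (2 * sqrt C * sqrt 3 * (l ^ d * x) powr (1 / 2))"
      using C0 by (intro mult_nonneg_nonneg) (auto simp: le_max_iff_disj)
    finally show ?thesis .
  next
    case False
    then have "E \<noteq> 0 \<or> 2 \<le> card G" using card_pos by linarith
    then have x_ge: "ln 2 \<le> x"
      unfolding x_def by (rule excess_ge_ln_2[OF H(1,2) \<psi>(1) \<psi>1 \<psi>(2) E \<beta> G Gne])
    then have x: "1 / 2 \<le> x" using half_le_ln_2 by linarith
    have "(\<Sum>g\<in>G. exp (- \<beta> * 0)) \<le> ?Z"
      by (rule partition_function_ge[OF H(1,2) Gc ground])
    then have "real (card G) \<le> ?Z" by simp
    then have Z: "0 < ?Z" using card_pos by linarith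
    \<comment> \<open>Since x >= 1 / 2, rounding up costs at most a factor 3: x + 1 <= 3 *
      x.\<close>
    define k where "k = nat \<lceil>x\<rceil>"
    have k: "1 \<le> k" "x \<le> real k" "real k \<le> 3 * x"
      using x by (auto simp: k_def) linarith+
    define \<mu> where "\<mu> i = trace (?\<rho> * w i)" for i
    define h where "h i = w i + (- \<mu> i) \<cdot>\<^sub>m 1\<^sub>m ?N" for i
    have \<rho>_carrier: "?\<rho> \<in> carrier_mat ?N ?N" by (rule canonical_state_carrier[OF H(1)])
    have w_bounded: "op_bounded ?N (w i) 1" if "i < n" for i
      using op_bounded_mono[OF op_bounded_op_norm[OF w_carrier] w_norm] that by blast
    have \<mu>_real: "Im (\<mu> i) = 0" if "i < n" for i
      unfolding \<mu>_def
      using self_adjoint_canonical_state[OF H(1,2)] w_sa[OF that] w_carrier[OF that] \<rho>_carrier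
      by (intro Im_trace_self_adjoint) auto
    interpret centred_observable n d pos r \<xi> l ?\<rho> h
    proof
      show "1 \<le> d" "0 < r" "0 < \<xi>" "r \<le> l" "?\<rho> \<in> carrier_mat ?N ?N" "clustering n pos r \<xi> ?\<rho>"
        by fact+
      show "inj_on pos {..<n}" using L(2) by (rule bij_betw_imp_inj_on)
      show "length (pos j) = d" if "j < n" for j
      proof -
        have "pos j \<in> lattice_box L" using L(2) that by (auto simp: bij_betw_def)
        then show ?thesis using L(1) by (simp add: lattice_box_def)
      qed
      show "cmod (trace (?\<rho> * A)) \<le> c" if "op_bounded ?N A c" for A c
        by (rule cmod_trace_canonical_state_le[OF H(1,2) Z that])
      fix i assume i: "i < n"
      show "acts_on n (site_ball n pos i l) (h i)"
        unfolding h_def by (rule acts_on_add_scalar[OF _ w_acts[OF i]]) (auto simp: site_ball_def)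
      have "cmod (\<mu> i) \<le> 1"
        unfolding \<mu>_def by (rule cmod_trace_canonical_state_le[OF H(1,2) Z w_bounded[OF i]])
      then show "op_bounded ?N (h i) 2"
        using op_bounded_add_scalar[OF w_bounded[OF i], of "- \<mu> i" 1] by (simp add: h_def)
      show "trace (?\<rho> * h i) = 0"
        unfolding h_def trace_mult_add_scalar[OF \<rho>_carrier w_carrier[OF i]]
        using trace_canonical_state[OF H(1,2) Z] by (simp add: \<mu>_def)
    qed
    define W where "W = site_sum n h"
    define m where "m = (\<Sum>i<n. \<mu> i)"
    define B where "B = sqrt (C * real n * (real k * (max l (real k)) ^ d))"
    have W_sa: "self_adjoint W"
      unfolding W_def
    proof (rule self_adjoint_site_sum)
      show "self_adjoint (h i)" if "i < n" for i
        unfolding h_def using w_carrier w_sa \<mu>_real that by (intro self_adjoint_add_scalar) auto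
    qed (rule h_carrier)
    have B_eq: "sqrt (exp 1 * moment_const r \<xi> * 16 * real n * real k * (length_const d r \<xi> * max l (real k)) ^ d) = B"
      unfolding B_def C_def by (rule arg_cong[where f=sqrt]) (simp add: power_mult_distrib mult_ac)
    \<comment> \<open>Lower energy only decreases the excess, so the same \<open>k\<close> and
      \<open>B\<close> cover \<open>\<psi>\<close> and, with e = 0, every ground state.\<close>
    have bound: "cmod (expect W \<phi>) \<le> B"
      if "\<phi> \<in> carrier_vec ?N" "vnorm \<phi> = 1" "H *\<^sub>v \<phi> = complex_of_real e \<cdot>\<^sub>v \<phi>" "e \<le> E" for \<phi> e
    proof -
      have "\<beta> * e \<le> \<beta> * E" using \<beta> that(4) by (intro mult_left_mono) auto
      then have "\<beta> * e + ln ?Z \<le> real k" using k(2) by (simp add: x_def)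
      then show ?thesis
        unfolding W_def B_eq[symmetric]
        using eigenstate_expect_bound[OF H(1,2) Z refl W_sa[unfolded W_def] that(1-3) k(1)] by blast
    qed
    have W_eq: "W = site_sum n w + (- m) \<cdot>\<^sub>m 1\<^sub>m ?N"
      unfolding W_def h_def m_def
      by (subst site_sum_add_scalar) (simp_all add: w_carrier sum_negf)
    have expect_\<Omega>: "expect \<Omega> \<phi> = (expect W \<phi> + m) / of_nat n"
      if "\<phi> \<in> carrier_vec ?N" "vnorm \<phi> = 1" for \<phi>
      unfolding \<Omega>_def W_eq expect_smult[OF site_sum_carrier that(1)]
        expect_add_scalar[OF site_sum_carrier that]
      by simp
    \<comment> \<open>The ground-state average of the centred observable. The total canonical mean
      \<open>m\<close> shifts it and the expectation in \<open>\<psi>\<close> equally, and so drops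
      out of the difference.\<close>
    define a where "a = (\<Sum>g\<in>G. expect W g) / of_nat (card G)"
    have "average \<Omega> G = (\<Sum>g\<in>G. (expect W g + m) / of_nat n) / of_nat (card G)"
      unfolding average_def using expect_\<Omega> Gc G1 by (auto intro!: arg_cong2[where f="(/)"] sum.cong)
    also have "\<dots> = (a + m) / of_nat n"
      using card_pos by (simp add: a_def sum_divide_distrib[symmetric] sum.distrib field_simps)
    finally have "expect \<Omega> \<psi> - average \<Omega> G = (expect W \<psi> - a) / of_nat n"
      using expect_\<Omega>[OF \<psi>(1) \<psi>1] by (simp add: diff_divide_distrib[symmetric])
    then have "cmod (expect \<Omega> \<psi> - average \<Omega> G) = cmod (expect W \<psi> - a) / real n"
      by (simp add: norm_divide)
    also have "\<dots> \<le> (2 * B) / real n"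
    proof (intro divide_right_mono)
      have "cmod (\<Sum>g\<in>G. expect W g) \<le> (\<Sum>g\<in>G. B)"
        using Gc G1 ground E by (intro order_trans[OF norm_sum] sum_mono bound) auto
      then have "cmod a \<le> B"
        using card_pos by (simp add: a_def norm_divide field_simps)
      moreover have "cmod (expect W \<psi>) \<le> B" by (rule bound[OF \<psi>(1) \<psi>1 \<psi>(2)]) simp
      ultimately show "cmod (expect W \<psi> - a) \<le> 2 * B"
        using norm_triangle_ineq4[of "expect W \<psi>" a] by linarith
    qed simp
    also have "\<dots> = 1 / sqrt (real n) * (2 * sqrt C * sqrt (real k * (max l (real k)) ^ d))"
    proof -
      have "sqrt (real n) * sqrt (real n) = real n" by simp
      then show ?thesis using n by (simp add: B_def real_sqrt_mult field_simps)
    qed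
    also have "\<dots> \<le> 1 / sqrt (real n) * (2 * sqrt C *
        max (3 powr ((real d + 1) / 2) * x powr ((real d + 1) / 2)) (sqrt 3 * (l ^ d * x) powr (1 / 2)))"
      using k x r rl C0 by (intro mult_left_mono sqrt_scale_le) auto
    also have "\<dots> = 1 / sqrt (real n) *
      max (2 * sqrt C * 3 powr ((real d + 1) / 2) * x powr ((real d + 1) / 2))
          (2 * sqrt C * sqrt 3 * (l ^ d * x) powr (1 / 2))"
      using C0 by (simp add: max_mult_distrib_left mult.assoc)
    finally show ?thesis .
  qed
qed

theorem theorem1:
  fixes d :: nat and r \<xi> l0 :: real
  assumes "1 \<le> d" and "0 < r" and "0 < \<xi>"
  shows "\<exists>c1 c2 :: real. 0 < c1 \<and> 0 < c2 \<and>
    (\<forall>(n::nat) (L::nat list) (pos::nat \<Rightarrow> nat list)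
       (h::nat \<Rightarrow> complex mat) (w::nat \<Rightarrow> complex mat) (H::complex mat) (\<Omega>::complex mat)
       (l::real) (\<beta>::real) (Em::real) (\<psi>::complex vec) (G::complex vec set).
       0 < n \<longrightarrow> length L = d \<longrightarrow> bij_betw pos {..<n} (lattice_box L) \<longrightarrow>
       local_terms n pos l0 h \<longrightarrow> H = site_sum n h \<longrightarrow> zero_ground_energy H \<longrightarrow>
       r \<le> l \<longrightarrow> local_terms n pos l w \<longrightarrow> \<Omega> = site_sum n w \<longrightarrow>
       0 < \<beta> \<longrightarrow> clustering n pos r \<xi> (canonical_state \<beta> H) \<longrightarrow>
       eigenvector H \<psi> (complex_of_real Em) \<longrightarrow> vnorm \<psi> = 1 \<longrightarrow>
       orthonormal_basis (2 ^ n) (eigenspace H 0) G \<longrightarrow>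
       (let \<Omega>n = complex_of_real (1 / real n) \<cdot>\<^sub>m \<Omega>;
            x = \<beta> * Em + ln (partition_function \<beta> H);
            A1 = x powr ((real d + 1) / 2);
            A2 = (l ^ d * x) powr (1 / 2)
        in cmod (expect \<Omega>n \<psi> - average \<Omega>n G) \<le> 1 / sqrt (real n) * max (c1 * A1) (c2 * A2)))"
proof -
  define C where "C = exp 1 * moment_const r \<xi> * 16 * length_const d r \<xi> ^ d"
  have C: "0 < C"
    using moment_const_ge_one[OF assms(2,3)] assms by (auto simp: C_def length_const_def intro!: mult_pos_pos zero_less_power add_pos_nonneg)
  \<comment> \<open>In both witnesses the factor 2 is the triangle inequality through the canonical
    mean, sqrt C stems from the moment bound, and the power of 3 from rounding the excess.\<close>
  show ?thesis
  proof (rule exI[of _ "2 * sqrt C * 3 powr ((real d + 1) / 2)"], rule exI[of _ "2 * sqrt C * sqrt 3"],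
      intro conjI allI impI)
    fix n L pos h w H \<Omega> l \<beta> Em \<psi> G
    assume a: "0 < n" "length L = d" "bij_betw pos {..<n} (lattice_box L)" "local_terms n pos l0 h"
      "H = site_sum n h" "zero_ground_energy H" "r \<le> l" "local_terms n pos l w" "\<Omega> = site_sum n w"
      "0 < \<beta>" "clustering n pos r \<xi> (canonical_state \<beta> H)"
      "eigenvector H \<psi> (complex_of_real Em)" "vnorm \<psi> = 1"
      "orthonormal_basis (2 ^ n) (eigenspace H 0) G"
    have "self_adjoint H"
      unfolding a(5) using a(4) by (intro self_adjoint_site_sum) (auto simp: local_terms_def acts_on_def)
    moreover have "H \<in> carrier_mat (2 ^ n) (2 ^ n)" by (simp add: a(5))
    ultimately show "let \<Omega>n = complex_of_real (1 / real n) \<cdot>\<^sub>m \<Omega>;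
            x = \<beta> * Em + ln (partition_function \<beta> H);
            A1 = x powr ((real d + 1) / 2);
            A2 = (l ^ d * x) powr (1 / 2)
        in cmod (expect \<Omega>n \<psi> - average \<Omega>n G) \<le> 1 / sqrt (real n) *
          max (2 * sqrt C * 3 powr ((real d + 1) / 2) * A1) (2 * sqrt C * sqrt 3 * A2)"
      unfolding Let_def a(9) C_def
      by (intro eigenstate_deviation[OF assms a(1-3) _ _ a(6-8) a(10-14)])
  qed (use C in auto)
qed

end
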